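(* Let $\ell\geq 3$ be an odd integer, let $q=e^{2\pi i/\ell}$, and let $W_n$, $V_m$ be the $A(SL_q(2))$-comodules defined in the context. Then the corepresentations $W_n\otimes V_m$ of $A(SL_q(2))$ are irreducible for all $n\in\mathbb{N}=\{0,1,2,\dots\}$ and all $m\in\{0,1,\dots,\ell-1\}$.
   Context: For $q\in\mathbb{C}$, $q\neq 0$, $A(SL_q(2))$ is the unital associative $\mathbb{C}$-algebra generated by $a,b,c,d$ subject to the relations $$ab=q\,ba,\quad ac=q\,ca,\quad bd=q\,db,\quad bc=cb,\quad cd=q\,dc,\quad ad-da=(q-q^{-1})bc,\quad ad-q\,bc=1.$$ It is a Hopf algebra with comultiplication, counit and antipode given on generators by $$\Delta a=a\otimes a+b\otimes c,\quad \Delta b=a\otimes b+b\otimes d,\quad \Delta c=c\otimes a+d\otimes c,\quad \Delta d=c\otimes b+d\otimes d,$$ $$\varepsilon(a)=\varepsilon(d)=1,\quad \varepsilon(b)=\varepsilon(c)=0,\quad S(a)=d,\quad S(b)=-q^{-1}b,\quad S(c)=-q\,c,\quad S(d)=a.$$ Here $q=e^{2\pi i/\ell}$ with $\ell\geq 3$ odd. Corepresentations are left comodules, i.e. vector spaces $U$ over $\mathbb{C}$ with a coaction $U\to A(SL_q(2))\otimes U$. For $m\in\{0,1,\dots,\ell-1\}$, $V_m$ is the linear span in $A(SL_q(2))$ of the monomials $a^m,a^{m-1}c,\dots,c^m$, with coaction the restriction of $\Delta$, $\Delta: V_m\to A(SL_q(2))\otimes V_m$. For $n\in\mathbb{N}$,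 $W_n$ is the linear span of $\alpha^n,\alpha^{n-1}\gamma,\dots,\gamma^n$, where $\alpha=a^\ell$ and $\gamma=c^\ell$, with coaction the restriction of $\Delta$, $\Delta: W_n\to A(SL_q(2))\otimes W_n$. The tensor product of two comodules carries the usual coaction defined by means of the multiplication of $A(SL_q(2))$. A comodule is irreducible if it is nonzero and has no subcomodules other than $0$ and itself. *)

theory Defs
  imports "HOL-Analysis.Analysis" "HOL-Library.Poly_Mapping"
begin

section \<open>Complex vector spaces and complex algebras\<close>

class complex_vector = ab_group_add +
  fixes scaleC :: "complex \<Rightarrow> 'a \<Rightarrow> 'a" (infixr "*\<^sub>C" 75)
  assumes scaleC_add_right: "r *\<^sub>C (x + y) = r *\<^sub>C x + r *\<^sub>C y"
    and scaleC_add_left: "(r + s) *\<^sub>C x = r *\<^sub>C x + s *\<^sub>C x"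
    and scaleC_scaleC: "r *\<^sub>C s *\<^sub>C x = (r * s) *\<^sub>C x"
    and scaleC_one: "1 *\<^sub>C x = x"

class complex_algebra_1 = complex_vector + ring_1 +
  assumes mult_scaleC_left: "(r *\<^sub>C x) * y = r *\<^sub>C (x * y)"
    and mult_scaleC_right: "x * (r *\<^sub>C y) = r *\<^sub>C (x * y)"

global_interpretation complex_vector: vector_space "scaleC :: complex \<Rightarrow> 'a \<Rightarrow> 'a::complex_vector"
  by unfold_locales (simp_all add: scaleC_add_right scaleC_add_left scaleC_scaleC scaleC_one)

abbreviation csubspace :: "'a::complex_vector set \<Rightarrow> bool"
  where "csubspace \<equiv> module.subspace scaleC"

abbreviation cspan :: "'a::complex_vector set \<Rightarrow> 'a set"
  where "cspan \<equiv> module.span scaleC"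

abbreviation clinear :: "('a::complex_vector \<Rightarrow> 'b::complex_vector) \<Rightarrow> bool"
  where "clinear \<equiv> Vector_Spaces.linear scaleC scaleC"

definition cbilinear :: "('a::complex_vector \<Rightarrow> 'b::complex_vector \<Rightarrow> 'c::complex_vector) \<Rightarrow> bool"
  where "cbilinear f \<longleftrightarrow> (\<forall>y. clinear (\<lambda>x. f x y)) \<and> (\<forall>x. clinear (f x))"

lemma clinearI:
  assumes "\<And>x y. f (x + y) = f x + f y" and "\<And>r x. f (r *\<^sub>C x) = r *\<^sub>C f x"
  shows "clinear f"
  by (simp add: Vector_Spaces.linear_iff complex_vector.vector_space_axioms assms)

lemma clinear_add: "clinear f \<Longrightarrow> f (x + y) = f x + f y"
  and clinear_scale: "clinear f \<Longrightarrow> f (r *\<^sub>C x) = r *\<^sub>C f x"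
  by (auto simp: Vector_Spaces.linear_iff)

lemma clinear_zero: "clinear f \<Longrightarrow> f 0 = 0"
  by (metis clinear_scale complex_vector.scale_zero_left)

lemma clinear_diff: "clinear f \<Longrightarrow> f (x - y) = f x - f y"
  by (metis add_diff_cancel_right' clinear_add diff_add_cancel)

lemma clinear_vanish_span:
  assumes "clinear f" "\<And>x. x \<in> S \<Longrightarrow> f x = 0" "p \<in> cspan S"
  shows "f p = 0"
  using assms(3)
  by (induction rule: complex_vector.span_induct_alt)
     (simp_all add: clinear_zero[OF assms(1)] clinear_add[OF assms(1)] clinear_scale[OF assms(1)] assms(2))

lemma cbilinearI:
  assumes "\<And>x x' y. f (x + x') y = f x y + f x' y" "\<And>r x y. f (r *\<^sub>C x) y = r *\<^sub>C f x y"
    and "\<And>x y y'. f x (y + y') = f x y + f x y'" "\<And>r x y. f x (r *\<^sub>C y) = r *\<^sub>C f x y"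
  shows "cbilinear f"
  unfolding cbilinear_def by (intro conjI allI clinearI assms)

lemma cbilinear_simps:
  assumes "cbilinear f"
  shows "f (x + x') y = f x y + f x' y" "f (r *\<^sub>C x) y = r *\<^sub>C f x y"
    and "f x (y + y') = f x y + f x y'" "f x (r *\<^sub>C y) = r *\<^sub>C f x y"
  using assms unfolding cbilinear_def by (metis clinear_add clinear_scale)+

instantiation complex :: complex_algebra_1
begin
definition scaleC_complex :: "complex \<Rightarrow> complex \<Rightarrow> complex"
  where "scaleC_complex = (*)"
instance
  by standard (simp_all add: scaleC_complex_def algebra_simps)
end


section \<open>Free vector spaces and free algebras\<close>

text \<open>
  The free complex vector space on a type \<open>'k\<close> is \<open>'k \<Rightarrow>\<^sub>0 complex\<close>. If \<open>'k\<close> is a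
  (not necessarily commutative) additively written monoid, the multiplication of
  \<open>'k \<Rightarrow>\<^sub>0 complex\<close> is the convolution product. Words form the free monoid under
  concatenation, so \<open>'g list \<Rightarrow>\<^sub>0 complex\<close> is the free unital associative algebra on \<open>'g\<close>.
\<close>

instantiation poly_mapping :: (type, complex_vector) complex_vector
begin
lift_definition scaleC_poly_mapping :: "complex \<Rightarrow> ('a \<Rightarrow>\<^sub>0 'b) \<Rightarrow> ('a \<Rightarrow>\<^sub>0 'b)"
  is "\<lambda>r f k. r *\<^sub>C f k"
  by (erule rev_finite_subset) auto
instance
  by standard (transfer, simp add: fun_eq_iff scaleC_add_right scaleC_add_left scaleC_scaleC scaleC_one)+
end

lemma lookup_scaleC: "Poly_Mapping.lookup (r *\<^sub>C p) k = r *\<^sub>C Poly_Mapping.lookup p k"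
  by transfer simp

lemma scaleC_single: "r *\<^sub>C Poly_Mapping.single k s = Poly_Mapping.single k (r *\<^sub>C s)"
  by (rule poly_mapping_eqI) (simp add: lookup_scaleC lookup_single when_def)

lemma poly_mapping_single_induct [case_names zero single add]:
  fixes p :: "'k \<Rightarrow>\<^sub>0 'b::comm_monoid_add"
  assumes "P 0" "\<And>k c. P (Poly_Mapping.single k c)" "\<And>p q. P p \<Longrightarrow> P q \<Longrightarrow> P (p + q)"
  shows "P p"
proof -
  have "P (\<Sum>k\<in>K. Poly_Mapping.single k (Poly_Mapping.lookup p k))" if "finite K" for K
    using that by (induction K rule: finite_induct) (auto intro: assms)
  moreover have "(\<Sum>k\<in>Poly_Mapping.keys p. Poly_Mapping.single k (Poly_Mapping.lookup p k)) = p"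
    by (rule poly_mapping_eqI)
       (auto simp: lookup_sum lookup_single when_def in_keys_iff)
  ultimately show ?thesis
    by (metis finite_keys)
qed

instance poly_mapping :: (monoid_add, complex_algebra_1) complex_algebra_1
proof
  fix r :: complex and x y :: "'a \<Rightarrow>\<^sub>0 'b"
  show "(r *\<^sub>C x) * y = r *\<^sub>C (x * y)"
  proof (induction x rule: poly_mapping_single_induct)
    case (single k c)
    show ?case
      by (induction y rule: poly_mapping_single_induct)
         (simp_all add: scaleC_single mult_single distrib_left scaleC_add_right mult_scaleC_left)
  qed (simp_all add: distrib_right scaleC_add_right)
  show "x * (r *\<^sub>C y) = r *\<^sub>C (x * y)"
  proof (induction x rule: poly_mapping_single_induct)
    case (single k c)
    show ?case
      by (induction y rule: poly_mapping_single_induct)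
         (simp_all add: scaleC_single mult_single distrib_left scaleC_add_right mult_scaleC_right)
  qed (simp_all add: distrib_right scaleC_add_right)
qed

definition linear_extension :: "('k \<Rightarrow> 'b::complex_vector) \<Rightarrow> ('k \<Rightarrow>\<^sub>0 complex) \<Rightarrow> 'b"
  where "linear_extension f p = (\<Sum>k\<in>Poly_Mapping.keys p. Poly_Mapping.lookup p k *\<^sub>C f k)"

lemma linear_extension_superset:
  assumes "finite K" "Poly_Mapping.keys p \<subseteq> K"
  shows "linear_extension f p = (\<Sum>k\<in>K. Poly_Mapping.lookup p k *\<^sub>C f k)"
  unfolding linear_extension_def using assms
  by (intro sum.mono_neutral_left) (auto simp: in_keys_iff)

lemma clinear_linear_extension: "clinear (linear_extension f)"
proof (rule clinearI)
  fix p q :: "'a \<Rightarrow>\<^sub>0 complex" and r :: complex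
  let ?K = "Poly_Mapping.keys p \<union> Poly_Mapping.keys q"
  have K: "finite ?K" "Poly_Mapping.keys (p + q) \<subseteq> ?K" "Poly_Mapping.keys p \<subseteq> ?K" "Poly_Mapping.keys q \<subseteq> ?K"
    using Poly_Mapping.keys_add[of p q] by auto
  show "linear_extension f (p + q) = linear_extension f p + linear_extension f q"
    by (simp add: linear_extension_superset[OF K(1,2)] linear_extension_superset[OF K(1,3)]
        linear_extension_superset[OF K(1,4)] lookup_add scaleC_add_left sum.distrib)
  have "Poly_Mapping.keys (r *\<^sub>C p) \<subseteq> Poly_Mapping.keys p"
    by (auto simp: in_keys_iff lookup_scaleC)
  then show "linear_extension f (r *\<^sub>C p) = r *\<^sub>C linear_extension f p"
    by (simp add: linear_extension_superset[of "Poly_Mapping.keys p"] lookup_scaleC scaleC_complex_def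
        complex_vector.scale_sum_right scaleC_scaleC)
qed

lemma linear_extension_single: "linear_extension f (Poly_Mapping.single k c) = c *\<^sub>C f k"
  by (simp add: linear_extension_def)

lemma linear_extension_fun_add:
  "linear_extension (\<lambda>k. f k + g k) p = linear_extension f p + linear_extension g p"
  by (simp add: linear_extension_def scaleC_add_right sum.distrib)

lemma linear_extension_fun_scale:
  "linear_extension (\<lambda>k. r *\<^sub>C f k) p = r *\<^sub>C linear_extension f p"
  by (simp add: linear_extension_def complex_vector.scale_sum_right scaleC_scaleC mult.commute)

instantiation list :: (type) monoid_add
begin
definition zero_list :: "'a list" where "zero_list = []"
definition plus_list :: "'a list \<Rightarrow> 'a list \<Rightarrow> 'a list" where "plus_list = (@)"
instance
  by standard (simp_all add: zero_list_def plus_list_def)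
end

type_synonym 'g free_algebra = "'g list \<Rightarrow>\<^sub>0 complex"

definition free_gen :: "'g \<Rightarrow> 'g free_algebra"
  where "free_gen g = Poly_Mapping.single [g] 1"

definition free_lift :: "('g \<Rightarrow> 'b::complex_algebra_1) \<Rightarrow> 'g free_algebra \<Rightarrow> 'b"
  where "free_lift h = linear_extension (\<lambda>w. prod_list (map h w))"

lemma clinear_free_lift: "clinear (free_lift h)"
  by (simp add: free_lift_def clinear_linear_extension)

lemma free_lift_gen [simp]: "free_lift h (free_gen g) = h g"
  by (simp add: free_lift_def free_gen_def linear_extension_single scaleC_one)

lemma free_lift_one [simp]: "free_lift h 1 = 1"
  by (simp add: free_lift_def linear_extension_single scaleC_one zero_list_def flip: single_one)

lemma free_lift_mult: "free_lift h (p * q) = free_lift h p * free_lift h q"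
proof (induction p rule: poly_mapping_single_induct)
  case (single k c)
  show ?case
  proof (induction q rule: poly_mapping_single_induct)
    case (single k' c')
    show ?case
      by (simp add: free_lift_def mult_single linear_extension_single plus_list_def
          mult_scaleC_left mult_scaleC_right scaleC_scaleC)
  qed (simp_all add: clinear_zero[OF clinear_free_lift] clinear_add[OF clinear_free_lift] distrib_left)
qed (simp_all add: clinear_zero[OF clinear_free_lift] clinear_add[OF clinear_free_lift] distrib_right)

definition two_sided_ideal :: "'a::complex_algebra_1 set \<Rightarrow> 'a set"
  where "two_sided_ideal R = cspan {x * r * y | x r y. r \<in> R}"

lemma two_sided_ideal_mult:
  assumes "p \<in> two_sided_ideal R"
  shows "z * p \<in> two_sided_ideal R" "p * z \<in> two_sided_ideal R"
proof -
  let ?S = "{x * r * y | x r y. r \<in> R}"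
  have "z * p \<in> cspan ?S \<and> p * z \<in> cspan ?S"
    using assms unfolding two_sided_ideal_def
  proof (induction rule: complex_vector.span_induct_alt)
    case base
    show ?case by (simp add: complex_vector.span_zero)
  next
    case (step c s p)
    then obtain x r y where s: "s = x * r * y" "r \<in> R" by auto
    have "z * s = (z * x) * r * y" "s * z = x * r * (y * z)"
      by (simp_all add: s(1) mult.assoc)
    with s(2) have "z * s \<in> ?S" "s * z \<in> ?S"
      by blast+
    then show ?case
      unfolding distrib_left distrib_right mult_scaleC_left mult_scaleC_right
      using step.IH by (intro conjI complex_vector.span_add complex_vector.span_scale)
        (simp_all only: complex_vector.span_base)
  qed
  then show "z * p \<in> two_sided_ideal R" "p * z \<in> two_sided_ideal R"
    by (simp_all add: two_sided_ideal_def)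
qed

lemma free_lift_ideal:
  assumes "\<And>r. r \<in> R \<Longrightarrow> free_lift h r = 0" "p \<in> two_sided_ideal R"
  shows "free_lift h p = 0"
  by (rule clinear_vanish_span[OF clinear_free_lift _ assms(2)[unfolded two_sided_ideal_def]])
     (auto simp: free_lift_mult assms(1))


section \<open>Tensor products over the complex numbers\<close>

definition tensor_relations :: "('a::complex_vector \<times> 'b::complex_vector \<Rightarrow>\<^sub>0 complex) set"
  where "tensor_relations =
    {Poly_Mapping.single (x + x', y) 1 - Poly_Mapping.single (x, y) 1 - Poly_Mapping.single (x', y) 1 | x x' y. True} \<union>
    {Poly_Mapping.single (x, y + y') 1 - Poly_Mapping.single (x, y) 1 - Poly_Mapping.single (x, y') 1 | x y y'. True} \<union>
    {Poly_Mapping.single (r *\<^sub>C x, y) 1 - r *\<^sub>C Poly_Mapping.single (x, y) 1 | r x y. True} \<union>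
    {Poly_Mapping.single (x, r *\<^sub>C y) 1 - r *\<^sub>C Poly_Mapping.single (x, y) 1 | r x y. True}"

definition tensor_eq ::
  "('a::complex_vector \<times> 'b::complex_vector \<Rightarrow>\<^sub>0 complex) \<Rightarrow> ('a \<times> 'b \<Rightarrow>\<^sub>0 complex) \<Rightarrow> bool"
  where "tensor_eq p p' \<longleftrightarrow> p - p' \<in> cspan tensor_relations"

lemma tensor_eq_refl: "p = p' \<Longrightarrow> tensor_eq p p'"
  by (simp add: tensor_eq_def complex_vector.span_zero)

lemma diff_diff_diff: "p - q - (p' - q') = p - p' - (q - q')" for p :: "'a::ab_group_add"
  by simp

lemma equivp_diff_span: "equivp (\<lambda>p p'. p - p' \<in> cspan S)"
proof (rule equivpI)
  show "reflp (\<lambda>p p'. p - p' \<in> cspan S)"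
    by (simp add: reflp_def complex_vector.span_zero)
  show "symp (\<lambda>p p'. p - p' \<in> cspan S)"
    by (rule sympI, drule complex_vector.span_neg) simp
  show "transp (\<lambda>p p'. p - p' \<in> cspan S)"
    by (rule transpI, drule (1) complex_vector.span_add) simp
qed

quotient_type (overloaded) ('a, 'b) tensor (infixr "\<otimes>\<^sub>c" 70) =
  "'a::complex_vector \<times> 'b::complex_vector \<Rightarrow>\<^sub>0 complex" / tensor_eq
  using equivp_diff_span[of tensor_relations] unfolding tensor_eq_def[abs_def] .

lemma abs_rep_tensor: "abs_tensor (rep_tensor t) = t"
  by (rule Quotient3_abs_rep[OF Quotient3_tensor])

instantiation tensor :: (complex_vector, complex_vector) complex_vector
begin
lift_definition zero_tensor :: "'a \<otimes>\<^sub>c 'b" is 0 .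
lift_definition plus_tensor :: "'a \<otimes>\<^sub>c 'b \<Rightarrow> 'a \<otimes>\<^sub>c 'b \<Rightarrow> 'a \<otimes>\<^sub>c 'b" is "(+)"
  unfolding tensor_eq_def by (simp only: add_diff_add complex_vector.span_add)
lift_definition uminus_tensor :: "'a \<otimes>\<^sub>c 'b \<Rightarrow> 'a \<otimes>\<^sub>c 'b" is uminus
  unfolding tensor_eq_def by (simp only: minus_diff_minus complex_vector.span_neg)
lift_definition minus_tensor :: "'a \<otimes>\<^sub>c 'b \<Rightarrow> 'a \<otimes>\<^sub>c 'b \<Rightarrow> 'a \<otimes>\<^sub>c 'b" is "(-)"
  unfolding tensor_eq_def by (simp only: diff_diff_diff complex_vector.span_diff)
lift_definition scaleC_tensor :: "complex \<Rightarrow> 'a \<otimes>\<^sub>c 'b \<Rightarrow> 'a \<otimes>\<^sub>c 'b" is scaleC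
  unfolding tensor_eq_def
  by (subst complex_vector.scale_right_diff_distrib[symmetric], erule complex_vector.span_scale)
instance
proof
  fix a b c :: "'a \<otimes>\<^sub>c 'b" and r s :: complex
  show "a + b + c = a + (b + c)" by transfer (simp add: tensor_eq_refl add.assoc)
  show "a + b = b + a" by transfer (simp add: tensor_eq_refl add.commute)
  show "0 + a = a" by transfer (simp add: tensor_eq_refl)
  show "- a + a = 0" by transfer (simp add: tensor_eq_refl)
  show "a - b = a + - b" by transfer (simp add: tensor_eq_refl)
  show "r *\<^sub>C (a + b) = r *\<^sub>C a + r *\<^sub>C b"
    by transfer (rule tensor_eq_refl, rule scaleC_add_right)
  show "(r + s) *\<^sub>C a = r *\<^sub>C a + s *\<^sub>C a"
    by transfer (rule tensor_eq_refl, rule scaleC_add_left)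
  show "r *\<^sub>C s *\<^sub>C a = (r * s) *\<^sub>C a"
    by transfer (rule tensor_eq_refl, rule scaleC_scaleC)
  show "1 *\<^sub>C a = a"
    by transfer (rule tensor_eq_refl, rule scaleC_one)
qed
end

lift_definition tensor_of :: "'a::complex_vector \<Rightarrow> 'b::complex_vector \<Rightarrow> 'a \<otimes>\<^sub>c 'b" (infixr "\<otimes>\<^sub>c" 70)
  is "\<lambda>x y. Poly_Mapping.single (x, y) 1" .

text \<open>The linear map induced by a bilinear map (it is independent of the representative
  chosen by \<open>rep_tensor\<close> only if the argument is bilinear).\<close>

definition tensor_lift ::
  "('a::complex_vector \<Rightarrow> 'b::complex_vector \<Rightarrow> 'c::complex_vector) \<Rightarrow> 'a \<otimes>\<^sub>c 'b \<Rightarrow> 'c"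
  where "tensor_lift f t = linear_extension (case_prod f) (rep_tensor t)"

lemma cbilinear_tensor_of: "cbilinear (\<otimes>\<^sub>c)"
proof -
  have rel: "abs_tensor p = abs_tensor p'" if "p - p' \<in> tensor_relations"
    for p p' :: "'a \<times> 'b \<Rightarrow>\<^sub>0 complex"
    using that by (simp add: tensor.abs_eq_iff tensor_eq_def complex_vector.span_base)
  show ?thesis
    by (rule cbilinearI; simp only: tensor_of.abs_eq plus_tensor.abs_eq scaleC_tensor.abs_eq;
        rule rel; simp only: diff_diff_eq[symmetric] tensor_relations_def Un_iff mem_Collect_eq; blast)
qed

lemma tensor_lift_abs:
  assumes "cbilinear f"
  shows "tensor_lift f (abs_tensor p) = linear_extension (case_prod f) p"
proof -
  have relations: "linear_extension (case_prod f) r = 0" if "r \<in> tensor_relations" for r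
    using that unfolding tensor_relations_def
    by (elim UnE CollectE exE)
       (simp_all add: linear_extension_single scaleC_one cbilinear_simps[OF assms]
          clinear_diff[OF clinear_linear_extension] clinear_scale[OF clinear_linear_extension])
  have "tensor_eq (rep_tensor (abs_tensor p)) p"
    by (rule Quotient3_rep_abs[OF Quotient3_tensor]) (simp add: tensor_eq_def complex_vector.span_zero)
  then have "linear_extension (case_prod f) (rep_tensor (abs_tensor p) - p) = 0"
    unfolding tensor_eq_def by (rule clinear_vanish_span[OF clinear_linear_extension, rotated]) (rule relations)
  then show ?thesis
    by (simp add: tensor_lift_def clinear_diff[OF clinear_linear_extension])
qed

lemma clinear_tensor_lift:
  assumes "cbilinear f"
  shows "clinear (tensor_lift f)"
proof (rule clinearI)
  fix s t :: "'a \<otimes>\<^sub>c 'b" and r :: complex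
  obtain p q where "s = abs_tensor p" "t = abs_tensor q"
    by (metis abs_rep_tensor)
  then show "tensor_lift f (s + t) = tensor_lift f s + tensor_lift f t"
    and "tensor_lift f (r *\<^sub>C s) = r *\<^sub>C tensor_lift f s"
    by (simp_all add: plus_tensor.abs_eq scaleC_tensor.abs_eq tensor_lift_abs[OF assms]
        clinear_add[OF clinear_linear_extension] clinear_scale[OF clinear_linear_extension])
qed

lemma tensor_lift_of: "cbilinear f \<Longrightarrow> tensor_lift f (x \<otimes>\<^sub>c y) = f x y"
  by (simp add: tensor_of.abs_eq tensor_lift_abs linear_extension_single scaleC_one)

lemma tensor_lift_fun_add: "tensor_lift (\<lambda>x y. f x y + g x y) t = tensor_lift f t + tensor_lift g t"
  and tensor_lift_fun_scale: "tensor_lift (\<lambda>x y. r *\<^sub>C f x y) t = r *\<^sub>C tensor_lift f t"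
  by (simp_all add: tensor_lift_def case_prod_unfold linear_extension_fun_add linear_extension_fun_scale)

lemma tensor_induct [case_names zero of add, induct type: tensor]:
  assumes "P 0" "\<And>x y. P (x \<otimes>\<^sub>c y)" "\<And>s t. P s \<Longrightarrow> P t \<Longrightarrow> P (s + t)"
  shows "P t"
proof -
  have "P (abs_tensor p)" for p
  proof (induction p rule: poly_mapping_single_induct)
    case zero
    then show ?case using assms(1) by (simp add: zero_tensor_def)
  next
    case (single k c)
    obtain x y where k: "k = (x, y)" by (cases k)
    have "abs_tensor (Poly_Mapping.single k c) = c *\<^sub>C (x \<otimes>\<^sub>c y)"
      by (simp add: k tensor_of.abs_eq scaleC_tensor.abs_eq scaleC_single scaleC_complex_def)
    also have "\<dots> = (c *\<^sub>C x) \<otimes>\<^sub>c y"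
      by (simp add: cbilinear_simps[OF cbilinear_tensor_of])
    finally show ?case using assms(2) by simp
  next
    case (add p q)
    then show ?case using assms(3) by (metis plus_tensor.abs_eq)
  qed
  then show ?thesis by (metis abs_rep_tensor)
qed

definition tensor_mult ::
  "'a::complex_algebra_1 \<otimes>\<^sub>c 'b::complex_algebra_1 \<Rightarrow> 'a \<otimes>\<^sub>c 'b \<Rightarrow> 'a \<otimes>\<^sub>c 'b"
  where "tensor_mult s t =
    tensor_lift (\<lambda>x y. tensor_lift (\<lambda>x' y'. (x * x') \<otimes>\<^sub>c (y * y')) t) s"

lemma cbilinear_tensor_mult: "cbilinear (tensor_mult :: 'a \<otimes>\<^sub>c 'b \<Rightarrow> 'a::complex_algebra_1 \<otimes>\<^sub>c 'b::complex_algebra_1 \<Rightarrow> _)"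
  and tensor_mult_of: "tensor_mult ((x :: 'a) \<otimes>\<^sub>c (y :: 'b)) (x' \<otimes>\<^sub>c y') = (x * x') \<otimes>\<^sub>c (y * y')"
proof -
  note simps = distrib_left distrib_right mult_scaleC_left mult_scaleC_right
    cbilinear_simps[OF cbilinear_tensor_of] tensor_lift_fun_add tensor_lift_fun_scale
  have inner: "cbilinear (\<lambda>x' y'. (x * x') \<otimes>\<^sub>c (y * y'))" for x :: 'a and y :: 'b
    by (rule cbilinearI) (simp_all add: simps)
  have outer: "cbilinear (\<lambda>x y. tensor_lift (\<lambda>x' y'. (x * x') \<otimes>\<^sub>c (y * y')) t)" for t :: "'a \<otimes>\<^sub>c 'b"
    by (rule cbilinearI) (simp_all add: simps)
  show "cbilinear (tensor_mult :: 'a \<otimes>\<^sub>c 'b \<Rightarrow> _)"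
    by (rule cbilinearI)
       (simp_all add: tensor_mult_def simps clinear_add[OF clinear_tensor_lift[OF outer]]
          clinear_scale[OF clinear_tensor_lift[OF outer]] clinear_add[OF clinear_tensor_lift[OF inner]]
          clinear_scale[OF clinear_tensor_lift[OF inner]])
  show "tensor_mult (x \<otimes>\<^sub>c y) (x' \<otimes>\<^sub>c y') = (x * x') \<otimes>\<^sub>c (y * y')"
    by (subst tensor_mult_def, subst tensor_lift_of[OF outer], rule tensor_lift_of[OF inner])
qed

lemma tensor_of_zero [simp]: "0 \<otimes>\<^sub>c y = 0" "x \<otimes>\<^sub>c 0 = 0"
  using cbilinear_tensor_of unfolding cbilinear_def by (metis clinear_zero)+

lemma ex_functional_one: "\<exists>f :: 'a::complex_algebra_1 \<Rightarrow> complex. clinear f \<and> f 1 = 1"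
proof -
  interpret vector_space_pair "scaleC :: complex \<Rightarrow> 'a \<Rightarrow> 'a" "scaleC :: complex \<Rightarrow> complex \<Rightarrow> complex"
    by (simp add: vector_space_pair_def complex_vector.vector_space_axioms)
  have "complex_vector.independent {1 :: 'a}"
    by simp
  from linear_independent_extend[OF this, of "\<lambda>_. 1"] show ?thesis
    by auto
qed

instantiation tensor :: (complex_algebra_1, complex_algebra_1) complex_algebra_1
begin
definition times_tensor :: "'a \<otimes>\<^sub>c 'b \<Rightarrow> 'a \<otimes>\<^sub>c 'b \<Rightarrow> 'a \<otimes>\<^sub>c 'b" where "times_tensor = tensor_mult"
definition one_tensor :: "'a \<otimes>\<^sub>c 'b" where "one_tensor = 1 \<otimes>\<^sub>c 1"
instance
proof
  fix a b c :: "'a \<otimes>\<^sub>c 'b" and r :: complex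
  note bil = cbilinear_simps[OF cbilinear_tensor_mult[where ?'a = 'a and ?'b = 'b], folded times_tensor_def]
  note mult_of = tensor_mult_of[where ?'a = 'a and ?'b = 'b, folded times_tensor_def]
  have zero: "0 * t = 0" "t * 0 = 0" for t :: "'a \<otimes>\<^sub>c 'b"
    using bil(2)[of 0 0 t] bil(4)[of t 0 0] by simp_all
  show "(a + b) * c = a * c + b * c" "a * (b + c) = a * b + a * c"
    "(r *\<^sub>C a) * b = r *\<^sub>C (a * b)" "a * (r *\<^sub>C b) = r *\<^sub>C (a * b)"
    by (fact bil)+
  show "a * b * c = a * (b * c)"
  proof (induction a)
    case (of x x')
    show ?case
    proof (induction b)
      case (of y y')
      show ?case
        by (induction c) (simp_all add: zero bil mult_of mult.assoc)
    qed (simp_all add: zero bil)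
  qed (simp_all add: zero bil)
  show "1 * a = a"
    unfolding one_tensor_def by (induction a) (simp_all add: zero bil mult_of)
  show "a * 1 = a"
    unfolding one_tensor_def by (induction a) (simp_all add: zero bil mult_of)
  show "(0 :: 'a \<otimes>\<^sub>c 'b) \<noteq> 1"
  proof
    assume eq: "(0 :: 'a \<otimes>\<^sub>c 'b) = 1"
    obtain f :: "'a \<Rightarrow> complex" where f: "clinear f" "f 1 = 1"
      using ex_functional_one by blast
    obtain g :: "'b \<Rightarrow> complex" where g: "clinear g" "g 1 = 1"
      using ex_functional_one by blast
    have bil: "cbilinear (\<lambda>x y. f x * g y)"
      by (rule cbilinearI)
         (simp_all add: clinear_add[OF f(1)] clinear_scale[OF f(1)] clinear_add[OF g(1)]
            clinear_scale[OF g(1)] scaleC_complex_def algebra_simps)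
    have "tensor_lift (\<lambda>x y. f x * g y) (1 \<otimes>\<^sub>c 1) = 1"
      by (simp add: tensor_lift_of[OF bil] f(2) g(2))
    moreover have "tensor_lift (\<lambda>x y. f x * g y) 0 = 0"
      by (rule clinear_zero[OF clinear_tensor_lift[OF bil]])
    ultimately show False
      using eq by (simp add: one_tensor_def)
  qed
qed
end


section \<open>The quantum group $SL_q(2)$\<close>

datatype gen = GA | GB | GC | GD

definition slq2_relations :: "complex \<Rightarrow> gen free_algebra set"
  where "slq2_relations q =
    (let a = free_gen GA; b = free_gen GB; c = free_gen GC; d = free_gen GD in
     {a * b - q *\<^sub>C (b * a),
      a * c - q *\<^sub>C (c * a),
      b * d - q *\<^sub>C (d * b),
      b * c - c * b,
      c * d - q *\<^sub>C (d * c),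
      (a * d - d * a) - (q - inverse q) *\<^sub>C (b * c),
      (a * d - q *\<^sub>C (b * c)) - 1})"

definition slq2_eq :: "complex \<Rightarrow> gen free_algebra \<Rightarrow> gen free_algebra \<Rightarrow> bool"
  where "slq2_eq q p p' \<longleftrightarrow> p - p' \<in> two_sided_ideal (slq2_relations q)"

text \<open>The order \<open>\<ell>\<close> of the root of unity is carried by a type parameter: \<open>\<ell> = CARD('l)\<close>.
  Thus \<open>'l slq2\<close> is the algebra $A(SL_q(2))$ for $q = e^{2\pi i/\ell}$.\<close>

definition root_q :: "'l itself \<Rightarrow> complex"
  where "root_q _ = exp (2 * of_real pi * \<i> / of_nat CARD('l))"

lemma root_q_nonzero [simp]: "root_q L \<noteq> 0"
  by (simp add: root_q_def)

quotient_type 'l slq2 = "gen free_algebra" / "slq2_eq (root_q TYPE('l))"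
  using equivp_diff_span unfolding slq2_eq_def[abs_def] two_sided_ideal_def by blast

lemma slq2_eq_refl: "p = p' \<Longrightarrow> slq2_eq q p p'"
  by (simp add: slq2_eq_def two_sided_ideal_def complex_vector.span_zero)

lemma slq2_eq_lift:
  assumes "\<And>r. r \<in> slq2_relations q \<Longrightarrow> free_lift h r = 0" "slq2_eq q p p'"
  shows "free_lift h p = free_lift h p'"
  using free_lift_ideal[OF assms(1) assms(2)[unfolded slq2_eq_def]]
  by (simp add: clinear_diff[OF clinear_free_lift])

lemma free_lift_relations:
  assumes "h GA * h GB = q *\<^sub>C (h GB * h GA)"
    and "h GA * h GC = q *\<^sub>C (h GC * h GA)"
    and "h GB * h GD = q *\<^sub>C (h GD * h GB)"
    and "h GB * h GC = h GC * h GB"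
    and "h GC * h GD = q *\<^sub>C (h GD * h GC)"
    and "h GA * h GD - h GD * h GA = (q - inverse q) *\<^sub>C (h GB * h GC)"
    and "h GA * h GD - q *\<^sub>C (h GB * h GC) = 1"
    and "r \<in> slq2_relations q"
  shows "free_lift h r = 0"
  using assms(8) unfolding slq2_relations_def Let_def insert_iff empty_iff
  by (elim disjE FalseE)
     (simp_all only: clinear_diff[OF clinear_free_lift] clinear_scale[OF clinear_free_lift]
        free_lift_mult free_lift_gen free_lift_one assms(1-3,5-7) assms(4)[symmetric] diff_self)

fun counit_gen :: "gen \<Rightarrow> complex"
  where "counit_gen GA = 1" | "counit_gen GB = 0" | "counit_gen GC = 0" | "counit_gen GD = 1"

lemma counit_gen_relations: "r \<in> slq2_relations q \<Longrightarrow> free_lift counit_gen r = 0"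
  by (rule free_lift_relations) (simp_all add: scaleC_complex_def)

instantiation slq2 :: (type) complex_algebra_1
begin
lift_definition zero_slq2 :: "'a slq2" is 0 .
lift_definition one_slq2 :: "'a slq2" is 1 .
lift_definition plus_slq2 :: "'a slq2 \<Rightarrow> 'a slq2 \<Rightarrow> 'a slq2" is "(+)"
  unfolding slq2_eq_def two_sided_ideal_def by (simp only: add_diff_add complex_vector.span_add)
lift_definition uminus_slq2 :: "'a slq2 \<Rightarrow> 'a slq2" is uminus
  unfolding slq2_eq_def two_sided_ideal_def by (simp only: minus_diff_minus complex_vector.span_neg)
lift_definition minus_slq2 :: "'a slq2 \<Rightarrow> 'a slq2 \<Rightarrow> 'a slq2" is "(-)"
  unfolding slq2_eq_def two_sided_ideal_def by (simp only: diff_diff_diff complex_vector.span_diff)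
lift_definition scaleC_slq2 :: "complex \<Rightarrow> 'a slq2 \<Rightarrow> 'a slq2" is scaleC
  unfolding slq2_eq_def two_sided_ideal_def
  by (subst complex_vector.scale_right_diff_distrib[symmetric], erule complex_vector.span_scale)
lift_definition times_slq2 :: "'a slq2 \<Rightarrow> 'a slq2 \<Rightarrow> 'a slq2" is "(*)"
proof -
  fix p p' r r' :: "gen free_algebra"
  let ?I = "two_sided_ideal (slq2_relations (root_q TYPE('a)))"
  assume "slq2_eq (root_q TYPE('a)) p p'" "slq2_eq (root_q TYPE('a)) r r'"
  then have "(p - p') * r \<in> ?I" "p' * (r - r') \<in> ?I"
    unfolding slq2_eq_def by (simp_all add: two_sided_ideal_mult)
  then have "(p - p') * r + p' * (r - r') \<in> ?I"
    unfolding two_sided_ideal_def by (rule complex_vector.span_add)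
  also have "(p - p') * r + p' * (r - r') = p * r - p' * r'"
    by (simp add: left_diff_distrib right_diff_distrib)
  finally show "slq2_eq (root_q TYPE('a)) (p * r) (p' * r')"
    unfolding slq2_eq_def .
qed
instance
proof
  fix a b c :: "'a slq2" and r s :: complex
  show "a + b + c = a + (b + c)" by transfer (rule slq2_eq_refl, rule add.assoc)
  show "a + b = b + a" by transfer (rule slq2_eq_refl, rule add.commute)
  show "0 + a = a" by transfer (rule slq2_eq_refl, rule add_0_left)
  show "- a + a = 0" by transfer (rule slq2_eq_refl, rule left_minus)
  show "a - b = a + - b" by transfer (rule slq2_eq_refl, rule diff_conv_add_uminus)
  show "r *\<^sub>C (a + b) = r *\<^sub>C a + r *\<^sub>C b"
    by transfer (rule slq2_eq_refl, rule scaleC_add_right)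
  show "(r + s) *\<^sub>C a = r *\<^sub>C a + s *\<^sub>C a"
    by transfer (rule slq2_eq_refl, rule scaleC_add_left)
  show "r *\<^sub>C s *\<^sub>C a = (r * s) *\<^sub>C a"
    by transfer (rule slq2_eq_refl, rule scaleC_scaleC)
  show "1 *\<^sub>C a = a"
    by transfer (rule slq2_eq_refl, rule scaleC_one)
  show "a * b * c = a * (b * c)" by transfer (rule slq2_eq_refl, rule mult.assoc)
  show "(a + b) * c = a * c + b * c" by transfer (rule slq2_eq_refl, rule distrib_right)
  show "a * (b + c) = a * b + a * c" by transfer (rule slq2_eq_refl, rule distrib_left)
  show "1 * a = a" by transfer (rule slq2_eq_refl, rule mult_1_left)
  show "a * 1 = a" by transfer (rule slq2_eq_refl, rule mult_1_right)
  show "(r *\<^sub>C a) * b = r *\<^sub>C (a * b)" by transfer (rule slq2_eq_refl, rule mult_scaleC_left)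
  show "a * (r *\<^sub>C b) = r *\<^sub>C (a * b)" by transfer (rule slq2_eq_refl, rule mult_scaleC_right)
  show "(0 :: 'a slq2) \<noteq> 1"
  proof (transfer, rule notI)
    assume "slq2_eq (root_q TYPE('a)) 0 1"
    then have "free_lift counit_gen 0 = free_lift counit_gen 1"
      by (intro slq2_eq_lift[OF counit_gen_relations])
    then show False
      by (simp add: clinear_zero[OF clinear_free_lift])
  qed
qed
end

lemmas tensor_times_of = tensor_mult_of[folded times_tensor_def]

lift_definition slq2_gen :: "gen \<Rightarrow> 'l slq2" is free_gen .

lemma slq2_gen_relations:
  defines "q \<equiv> root_q TYPE('l)"
  defines "a \<equiv> slq2_gen GA :: 'l slq2" and "b \<equiv> slq2_gen GB :: 'l slq2"
    and "c \<equiv> slq2_gen GC :: 'l slq2" and "d \<equiv> slq2_gen GD :: 'l slq2"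
  shows "a * b = q *\<^sub>C (b * a)" "a * c = q *\<^sub>C (c * a)" "b * d = q *\<^sub>C (d * b)"
    "b * c = c * b" "c * d = q *\<^sub>C (d * c)"
    "a * d - d * a = (q - inverse q) *\<^sub>C (b * c)" "a * d - q *\<^sub>C (b * c) = 1"
proof -
  have rel: "r \<in> two_sided_ideal (slq2_relations q)" if "r \<in> slq2_relations q" for r
    unfolding two_sided_ideal_def
    by (rule complex_vector.span_base) (use that in \<open>force intro: exI[of _ 1]\<close>)
  show "a * b = q *\<^sub>C (b * a)" "a * c = q *\<^sub>C (c * a)" "b * d = q *\<^sub>C (d * b)"
    "b * c = c * b" "c * d = q *\<^sub>C (d * c)"
    "a * d - d * a = (q - inverse q) *\<^sub>C (b * c)" "a * d - q *\<^sub>C (b * c) = 1"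
    unfolding a_def b_def c_def d_def q_def
    by (transfer, unfold slq2_eq_def, rule rel[unfolded q_def], simp add: slq2_relations_def Let_def)+
qed

fun comult_gen :: "gen \<Rightarrow> 'l slq2 \<otimes>\<^sub>c 'l slq2"
  where
    "comult_gen GA = slq2_gen GA \<otimes>\<^sub>c slq2_gen GA + slq2_gen GB \<otimes>\<^sub>c slq2_gen GC"
  | "comult_gen GB = slq2_gen GA \<otimes>\<^sub>c slq2_gen GB + slq2_gen GB \<otimes>\<^sub>c slq2_gen GD"
  | "comult_gen GC = slq2_gen GC \<otimes>\<^sub>c slq2_gen GA + slq2_gen GD \<otimes>\<^sub>c slq2_gen GC"
  | "comult_gen GD = slq2_gen GC \<otimes>\<^sub>c slq2_gen GB + slq2_gen GD \<otimes>\<^sub>c slq2_gen GD"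

lemma comult_gen_relations:
  assumes "r \<in> slq2_relations (root_q TYPE('l))"
  shows "free_lift (comult_gen :: gen \<Rightarrow> 'l slq2 \<otimes>\<^sub>c 'l slq2) r = 0"
proof -
  define q where "q = root_q TYPE('l)"
  have q: "q \<noteq> 0" by (simp add: q_def)
  define a b c d where "a = (slq2_gen GA :: 'l slq2)" and "b = (slq2_gen GB :: 'l slq2)"
    and "c = (slq2_gen GC :: 'l slq2)" and "d = (slq2_gen GD :: 'l slq2)"
  note rel = slq2_gen_relations[where 'l = 'l, folded q_def a_def b_def c_def d_def]
  have ad: "a * d = 1 + q *\<^sub>C (b * c)"
    using rel(7) by (simp add: algebra_simps)
  have da: "d * a = 1 + inverse q *\<^sub>C (b * c)"
    using rel(6) by (simp add: ad algebra_simps complex_vector.scale_left_diff_distrib)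
  have db: "d * b = inverse q *\<^sub>C (b * d)" and dc: "d * c = inverse q *\<^sub>C (c * d)"
    using q by (simp_all add: rel scaleC_scaleC scaleC_one)
  have bil: "(x + x') \<otimes>\<^sub>c y = x \<otimes>\<^sub>c y + x' \<otimes>\<^sub>c y" "(s *\<^sub>C x) \<otimes>\<^sub>c y = s *\<^sub>C (x \<otimes>\<^sub>c y)"
    "x \<otimes>\<^sub>c (y + y') = x \<otimes>\<^sub>c y + x \<otimes>\<^sub>c y'" "x \<otimes>\<^sub>c (s *\<^sub>C y) = s *\<^sub>C (x \<otimes>\<^sub>c y)"
    for x x' y y' :: "'l slq2" and s
    by (simp_all add: cbilinear_simps[OF cbilinear_tensor_of])
  have gens: "comult_gen GA = a \<otimes>\<^sub>c a + b \<otimes>\<^sub>c c" "comult_gen GB = a \<otimes>\<^sub>c b + b \<otimes>\<^sub>c d"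
    "comult_gen GC = c \<otimes>\<^sub>c a + d \<otimes>\<^sub>c c" "comult_gen GD = c \<otimes>\<^sub>c b + d \<otimes>\<^sub>c d"
    by (simp_all add: a_def b_def c_def d_def)
  note normal = tensor_times_of distrib_left distrib_right rel(1,2) rel(4)[symmetric] ad da db dc bil
    scaleC_add_right scaleC_scaleC scaleC_one
  have "one": "1 = (1 :: 'l slq2) \<otimes>\<^sub>c (1 :: 'l slq2)"
    by (simp add: one_tensor_def)
  show ?thesis
  proof (rule free_lift_relations[OF _ _ _ _ _ _ _ assms, folded q_def], unfold gens)
    show "(a \<otimes>\<^sub>c a + b \<otimes>\<^sub>c c) * (a \<otimes>\<^sub>c b + b \<otimes>\<^sub>c d) = q *\<^sub>C ((a \<otimes>\<^sub>c b + b \<otimes>\<^sub>c d) * (a \<otimes>\<^sub>c a + b \<otimes>\<^sub>c c))"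
      using q by (simp add: normal)
    show "(a \<otimes>\<^sub>c a + b \<otimes>\<^sub>c c) * (c \<otimes>\<^sub>c a + d \<otimes>\<^sub>c c) = q *\<^sub>C ((c \<otimes>\<^sub>c a + d \<otimes>\<^sub>c c) * (a \<otimes>\<^sub>c a + b \<otimes>\<^sub>c c))"
      using q by (simp add: normal)
    show "(a \<otimes>\<^sub>c b + b \<otimes>\<^sub>c d) * (c \<otimes>\<^sub>c b + d \<otimes>\<^sub>c d) = q *\<^sub>C ((c \<otimes>\<^sub>c b + d \<otimes>\<^sub>c d) * (a \<otimes>\<^sub>c b + b \<otimes>\<^sub>c d))"
      using q by (simp add: normal)
    show "(a \<otimes>\<^sub>c b + b \<otimes>\<^sub>c d) * (c \<otimes>\<^sub>c a + d \<otimes>\<^sub>c c) = (c \<otimes>\<^sub>c a + d \<otimes>\<^sub>c c) * (a \<otimes>\<^sub>c b + b \<otimes>\<^sub>c d)"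
      using q by (simp add: normal)
    show "(c \<otimes>\<^sub>c a + d \<otimes>\<^sub>c c) * (c \<otimes>\<^sub>c b + d \<otimes>\<^sub>c d) = q *\<^sub>C ((c \<otimes>\<^sub>c b + d \<otimes>\<^sub>c d) * (c \<otimes>\<^sub>c a + d \<otimes>\<^sub>c c))"
      using q by (simp add: normal)
    show "(a \<otimes>\<^sub>c a + b \<otimes>\<^sub>c c) * (c \<otimes>\<^sub>c b + d \<otimes>\<^sub>c d) - (c \<otimes>\<^sub>c b + d \<otimes>\<^sub>c d) * (a \<otimes>\<^sub>c a + b \<otimes>\<^sub>c c) =
      (q - inverse q) *\<^sub>C ((a \<otimes>\<^sub>c b + b \<otimes>\<^sub>c d) * (c \<otimes>\<^sub>c a + d \<otimes>\<^sub>c c))"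
      using q by (simp add: normal left_diff_distrib complex_vector.scale_left_diff_distrib algebra_simps)
    show "(a \<otimes>\<^sub>c a + b \<otimes>\<^sub>c c) * (c \<otimes>\<^sub>c b + d \<otimes>\<^sub>c d) - q *\<^sub>C ((a \<otimes>\<^sub>c b + b \<otimes>\<^sub>c d) * (c \<otimes>\<^sub>c a + d \<otimes>\<^sub>c c)) = 1"
      using q by (simp add: normal "one")
  qed
qed

lift_definition comult :: "'l slq2 \<Rightarrow> 'l slq2 \<otimes>\<^sub>c 'l slq2" is "free_lift comult_gen"
  by (rule slq2_eq_lift[OF comult_gen_relations])

lift_definition counit :: "'l slq2 \<Rightarrow> complex" is "free_lift counit_gen"
  by (rule slq2_eq_lift[OF counit_gen_relations])


section \<open>Left comodules\<close>

definition tensor_map ::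
  "('a::complex_vector \<Rightarrow> 'c::complex_vector) \<Rightarrow> ('b::complex_vector \<Rightarrow> 'd::complex_vector) \<Rightarrow>
    'a \<otimes>\<^sub>c 'b \<Rightarrow> 'c \<otimes>\<^sub>c 'd"
  where "tensor_map f g = tensor_lift (\<lambda>x y. f x \<otimes>\<^sub>c g y)"

definition tensor_assoc ::
  "('a::complex_vector \<otimes>\<^sub>c 'b::complex_vector) \<otimes>\<^sub>c 'c::complex_vector \<Rightarrow> 'a \<otimes>\<^sub>c ('b \<otimes>\<^sub>c 'c)"
  where "tensor_assoc = tensor_lift (\<lambda>s z. tensor_lift (\<lambda>x y. x \<otimes>\<^sub>c (y \<otimes>\<^sub>c z)) s)"

text \<open>For subspaces \<open>U\<close>, \<open>V\<close> of two vector spaces, their tensor product is realised inside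
  the tensor product of the ambient spaces (over a field the canonical map is injective).\<close>

definition tensor_space ::
  "'a::complex_vector set \<Rightarrow> 'b::complex_vector set \<Rightarrow> ('a \<otimes>\<^sub>c 'b) set"
  where "tensor_space U V = cspan {u \<otimes>\<^sub>c v | u v. u \<in> U \<and> v \<in> V}"

text \<open>A comodule is given by a subspace \<open>U\<close> of an ambient vector space together with a
  linear map \<open>\<delta>\<close> on the ambient space whose restriction to \<open>U\<close> is the coaction
  (every coaction on \<open>U\<close> extends linearly, and the values of \<open>\<delta>\<close> outside \<open>U\<close> are irrelevant).\<close>

definition comodule :: "('u::complex_vector \<Rightarrow> 'l slq2 \<otimes>\<^sub>c 'u) \<Rightarrow> 'u set \<Rightarrow> bool"
  where "comodule \<delta> U \<longleftrightarrow>
    csubspace U \<and> clinear \<delta> \<and> \<delta> ` U \<subseteq> tensor_space UNIV U \<and>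
    (\<forall>u\<in>U. tensor_assoc (tensor_map comult id (\<delta> u)) = tensor_map id \<delta> (\<delta> u)) \<and>
    (\<forall>u\<in>U. tensor_lift (\<lambda>x v. counit x *\<^sub>C v) (\<delta> u) = u)"

definition subcomodule :: "('u::complex_vector \<Rightarrow> 'l slq2 \<otimes>\<^sub>c 'u) \<Rightarrow> 'u set \<Rightarrow> 'u set \<Rightarrow> bool"
  where "subcomodule \<delta> U M \<longleftrightarrow> csubspace M \<and> M \<subseteq> U \<and> \<delta> ` M \<subseteq> tensor_space UNIV M"

definition irreducible_comodule :: "('u::complex_vector \<Rightarrow> 'l slq2 \<otimes>\<^sub>c 'u) \<Rightarrow> 'u set \<Rightarrow> bool"
  where "irreducible_comodule \<delta> U \<longleftrightarrow>
    comodule \<delta> U \<and> U \<noteq> {0} \<and> (\<forall>M. subcomodule \<delta> U M \<longrightarrow> M = {0} \<or> M = U)"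

definition algebra_hom :: "('a::complex_algebra_1 \<Rightarrow> 'b::complex_algebra_1) \<Rightarrow> bool"
  where "algebra_hom f \<longleftrightarrow> clinear f \<and> f 1 = 1 \<and> (\<forall>x y. f (x * y) = f x * f y)"

lemma algebra_hom_comult: "algebra_hom comult"
  unfolding algebra_hom_def
proof (intro conjI allI clinearI)
  fix x y :: "'l slq2" and r :: complex
  show "comult (x + y) = comult x + comult y"
    by transfer (rule clinear_add[OF clinear_free_lift])
  show "comult (r *\<^sub>C x) = r *\<^sub>C comult x"
    by transfer (rule clinear_scale[OF clinear_free_lift])
  show "comult (1 :: 'l slq2) = 1"
    by transfer (rule free_lift_one)
  show "comult (x * y) = comult x * comult y"
    by transfer (rule free_lift_mult)
qed

lemma algebra_hom_counit: "algebra_hom (counit :: 'l slq2 \<Rightarrow> complex)"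
  unfolding algebra_hom_def
proof (intro conjI allI clinearI)
  fix x y :: "'l slq2" and r :: complex
  show "counit (x + y) = counit x + counit y"
    by transfer (rule clinear_add[OF clinear_free_lift])
  show "counit (r *\<^sub>C x) = r *\<^sub>C counit x"
    by transfer (rule clinear_scale[OF clinear_free_lift])
  show "counit (1 :: 'l slq2) = 1"
    by transfer (rule free_lift_one)
  show "counit (x * y) = counit x * counit y"
    by transfer (rule free_lift_mult)
qed

lemma comult_slq2_gen: "comult (slq2_gen g) = comult_gen g"
  by transfer simp

lemma counit_slq2_gen: "counit (slq2_gen g) = counit_gen g"
  by transfer simp

lemma slq2_induct [case_names one gen mult add scale]:
  assumes "P 1" "\<And>g. P (slq2_gen g)" "\<And>x y. P x \<Longrightarrow> P y \<Longrightarrow> P (x * y)"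
    and "\<And>x y. P x \<Longrightarrow> P y \<Longrightarrow> P (x + y)" "\<And>r x. P x \<Longrightarrow> P (r *\<^sub>C x)"
  shows "P (x :: 'l slq2)"
proof -
  have word: "P (abs_slq2 (Poly_Mapping.single w 1))" for w
  proof (induction w)
    case Nil
    show ?case using assms(1) by (simp add: one_slq2.abs_eq zero_list_def flip: single_one)
  next
    case (Cons g w)
    have "Poly_Mapping.single (g # w) 1 = free_gen g * Poly_Mapping.single w (1 :: complex)"
      by (simp add: free_gen_def mult_single plus_list_def)
    then show ?case
      using assms(3)[OF assms(2) Cons] by (simp add: times_slq2.abs_eq slq2_gen.abs_eq)
  qed
  have "P (abs_slq2 p)" for p
  proof (induction p rule: poly_mapping_single_induct)
    case zero
    then show ?case
      using assms(5)[OF assms(1), of 0] by (simp add: zero_slq2_def)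
  next
    case (single w r)
    then show ?case
      using assms(5)[OF word, of r] by (simp add: scaleC_slq2.abs_eq scaleC_single scaleC_complex_def)
  next
    case (add p p')
    then show ?case using assms(4) by (metis plus_slq2.abs_eq)
  qed
  then show ?thesis
    by (metis Quotient3_abs_rep[OF Quotient3_slq2])
qed

lemma algebra_hom_eqI:
  fixes f f' :: "'l slq2 \<Rightarrow> 'b::complex_algebra_1"
  assumes "algebra_hom f" "algebra_hom f'" "\<And>g. f (slq2_gen g) = f' (slq2_gen g)"
  shows "f x = f' x"
  using assms
  by (induction x rule: slq2_induct) (auto simp: algebra_hom_def clinear_add clinear_scale)

lemma algebra_hom_compose: "algebra_hom f \<Longrightarrow> algebra_hom f' \<Longrightarrow> algebra_hom (\<lambda>x. f (f' x))"
  by (auto simp: algebra_hom_def clinear_add clinear_scale intro!: clinearI)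

lemma algebra_hom_tensor_lift:
  assumes "cbilinear f" "f 1 1 = 1" "\<And>x y x' y'. f (x * x') (y * y') = f x y * f x' y'"
  shows "algebra_hom (tensor_lift f)"
proof -
  note lin = clinear_tensor_lift[OF assms(1)]
  have "tensor_lift f (s * t) = tensor_lift f s * tensor_lift f t" for s t
  proof (induction s)
    case (of x y)
    show ?case
      by (induction t)
         (simp_all add: distrib_left clinear_add[OF lin] clinear_zero[OF lin] tensor_times_of
            tensor_lift_of[OF assms(1)] assms(3))
  qed (simp_all add: distrib_right clinear_add[OF lin] clinear_zero[OF lin])
  then show ?thesis
    using lin by (simp add: algebra_hom_def one_tensor_def tensor_lift_of[OF assms(1)] assms(2))
qed

lemma cbilinear_tensor_map: "clinear f \<Longrightarrow> clinear g \<Longrightarrow> cbilinear (\<lambda>x y. f x \<otimes>\<^sub>c g y)"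
  by (rule cbilinearI) (simp_all add: clinear_add clinear_scale cbilinear_simps[OF cbilinear_tensor_of])

lemma clinear_algebra_hom: "algebra_hom f \<Longrightarrow> clinear f"
  by (simp add: algebra_hom_def)

lemma cbilinear_counit_scale: "cbilinear (\<lambda>x v. counit x *\<^sub>C v)"
proof -
  note lin = clinear_algebra_hom[OF algebra_hom_counit]
  show ?thesis
    by (rule cbilinearI)
       (simp_all add: clinear_add[OF lin] clinear_scale[OF lin] scaleC_add_left scaleC_add_right
          scaleC_scaleC scaleC_complex_def mult.commute)
qed

lemma cbilinear_tensor_assoc:
  "cbilinear (\<lambda>x y. x \<otimes>\<^sub>c (y \<otimes>\<^sub>c z))"
  "cbilinear (\<lambda>s z. tensor_lift (\<lambda>x y. x \<otimes>\<^sub>c (y \<otimes>\<^sub>c z)) s)"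
proof -
  show *: "cbilinear (\<lambda>x y. x \<otimes>\<^sub>c (y \<otimes>\<^sub>c z))" for z
    by (rule cbilinearI) (simp_all add: cbilinear_simps[OF cbilinear_tensor_of])
  show "cbilinear (\<lambda>s z. tensor_lift (\<lambda>x y. x \<otimes>\<^sub>c (y \<otimes>\<^sub>c z)) s)"
    by (rule cbilinearI)
       (simp_all add: cbilinear_simps[OF cbilinear_tensor_of] tensor_lift_fun_add tensor_lift_fun_scale
          clinear_add[OF clinear_tensor_lift[OF *]] clinear_scale[OF clinear_tensor_lift[OF *]])
qed

lemma algebra_hom_tensor_map:
  assumes "algebra_hom f" "algebra_hom g"
  shows "algebra_hom (tensor_map f g)"
  using assms unfolding tensor_map_def algebra_hom_def[of f] algebra_hom_def[of g]
  by (intro algebra_hom_tensor_lift cbilinear_tensor_map)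
     (auto simp: one_tensor_def tensor_times_of)

lemma tensor_assoc_of: "tensor_assoc ((x \<otimes>\<^sub>c y) \<otimes>\<^sub>c z) = x \<otimes>\<^sub>c (y \<otimes>\<^sub>c z)"
  by (subst tensor_assoc_def, subst tensor_lift_of[OF cbilinear_tensor_assoc(2)],
      rule tensor_lift_of[OF cbilinear_tensor_assoc(1)])

lemma algebra_hom_tensor_assoc: "algebra_hom tensor_assoc"
  unfolding tensor_assoc_def
proof (rule algebra_hom_tensor_lift[OF cbilinear_tensor_assoc(2)])
  fix s s' :: "'a \<otimes>\<^sub>c 'b" and z z' :: 'c
  let ?L = "\<lambda>z s. tensor_lift (\<lambda>x y. (x :: 'a) \<otimes>\<^sub>c ((y :: 'b) \<otimes>\<^sub>c (z :: 'c))) s"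
  note lin = clinear_tensor_lift[OF cbilinear_tensor_assoc(1)]
  show "?L 1 1 = 1"
    by (simp add: one_tensor_def tensor_lift_of[OF cbilinear_tensor_assoc(1)])
  show "?L (z * z') (s * s') = ?L z s * ?L z' s'"
  proof (induction s)
    case (of x y)
    show ?case
      by (induction s')
         (simp_all add: distrib_left clinear_add[OF lin] clinear_zero[OF lin] tensor_times_of
            tensor_lift_of[OF cbilinear_tensor_assoc(1)])
  qed (simp_all add: distrib_right clinear_add[OF lin] clinear_zero[OF lin])
qed

lemma comodule_comult: "comodule (comult :: 'l slq2 \<Rightarrow> _) UNIV"
proof -
  have id: "algebra_hom (id :: 'l slq2 \<Rightarrow> _)"
    by (auto simp: algebra_hom_def intro!: clinearI)
  have lin: "clinear (comult :: 'l slq2 \<Rightarrow> _)"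
    by (rule clinear_algebra_hom[OF algebra_hom_comult])
  have space: "t \<in> tensor_space UNIV UNIV" for t :: "'l slq2 \<otimes>\<^sub>c 'l slq2"
    unfolding tensor_space_def
    by (induction t)
       (auto intro: complex_vector.span_zero complex_vector.span_add complex_vector.span_base)
  have map_of: "tensor_map f g (x \<otimes>\<^sub>c y) = f x \<otimes>\<^sub>c g y" if "algebra_hom f" "algebra_hom g"
    for f :: "'l slq2 \<Rightarrow> 'b::complex_algebra_1" and g :: "'l slq2 \<Rightarrow> 'c::complex_algebra_1" and x y
    using that by (simp add: tensor_map_def algebra_hom_def tensor_lift_of cbilinear_tensor_map)
  note homs = algebra_hom_tensor_map[OF algebra_hom_comult id]
    algebra_hom_tensor_map[OF id algebra_hom_comult] algebra_hom_tensor_assoc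
  have add: "f (x + y) = f x + f y" if "algebra_hom f"
    for f :: "'b::complex_algebra_1 \<Rightarrow> 'c::complex_algebra_1" and x y
    using that by (simp add: algebra_hom_def clinear_add)
  have coassoc: "tensor_assoc (tensor_map comult id (comult x)) = tensor_map id comult (comult x)"
    for x :: "'l slq2"
  proof (rule algebra_hom_eqI[of "\<lambda>x. tensor_assoc (tensor_map comult id (comult x))"])
    fix g
    show "tensor_assoc (tensor_map comult id (comult (slq2_gen g :: 'l slq2))) =
      tensor_map id comult (comult (slq2_gen g))"
      by (cases g)
         (simp_all add: comult_slq2_gen add[OF homs(1)] add[OF homs(2)] add[OF homs(3)]
            map_of[OF algebra_hom_comult id] map_of[OF id algebra_hom_comult]
            cbilinear_simps[OF cbilinear_tensor_of] tensor_assoc_of)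
  qed (intro algebra_hom_compose[OF algebra_hom_tensor_assoc] algebra_hom_compose[OF homs(1)]
      algebra_hom_compose[OF homs(2)] algebra_hom_comult)+
  have hom_counit: "algebra_hom (tensor_lift (\<lambda>x v. counit (x :: 'l slq2) *\<^sub>C (v :: 'l slq2)))"
    using algebra_hom_counit[where 'l = 'l] unfolding algebra_hom_def[of counit]
    by (intro algebra_hom_tensor_lift cbilinear_counit_scale)
       (simp_all add: scaleC_one mult_scaleC_left mult_scaleC_right scaleC_scaleC mult.commute)
  have counit: "tensor_lift (\<lambda>x v. counit x *\<^sub>C v) (comult x) = x" for x :: "'l slq2"
  proof (rule algebra_hom_eqI[of "\<lambda>x. tensor_lift (\<lambda>x v. counit x *\<^sub>C v) (comult x)" "\<lambda>x. x"])
    fix g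
    show "tensor_lift (\<lambda>x v. counit x *\<^sub>C v) (comult (slq2_gen g :: 'l slq2)) = slq2_gen g"
      by (cases g)
         (simp_all add: comult_slq2_gen add[OF hom_counit] tensor_lift_of[OF cbilinear_counit_scale]
            counit_slq2_gen scaleC_one)
  qed (use id in \<open>auto intro: algebra_hom_compose[OF hom_counit algebra_hom_comult] simp: id_def\<close>)
  show ?thesis
    unfolding comodule_def
    using lin space coassoc counit by (auto simp: complex_vector.subspace_UNIV)
qed

text \<open>The coaction $u \otimes v \mapsto u_{(-1)} v_{(-1)} \otimes (u_{(0)} \otimes v_{(0)})$.\<close>

definition tensor_coaction ::
  "('u::complex_vector \<Rightarrow> 'l slq2 \<otimes>\<^sub>c 'u) \<Rightarrow> ('v::complex_vector \<Rightarrow> 'l slq2 \<otimes>\<^sub>c 'v) \<Rightarrow>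
    'u \<otimes>\<^sub>c 'v \<Rightarrow> 'l slq2 \<otimes>\<^sub>c ('u \<otimes>\<^sub>c 'v)"
  where "tensor_coaction \<delta> \<delta>' = tensor_lift (\<lambda>u v.
    tensor_lift (\<lambda>x u'. tensor_lift (\<lambda>y v'. (x * y) \<otimes>\<^sub>c (u' \<otimes>\<^sub>c v')) (\<delta>' v)) (\<delta> u))"

definition V_comod :: "nat \<Rightarrow> 'l slq2 set"
  where "V_comod m = cspan {slq2_gen GA ^ (m - k) * slq2_gen GC ^ k | k. k \<le> m}"

definition W_comod :: "nat \<Rightarrow> 'l slq2 set"
  where "W_comod n = cspan {(slq2_gen GA ^ CARD('l)) ^ (n - k) * (slq2_gen GC ^ CARD('l)) ^ k | k. k \<le> n}"

end

theory Submission
  imports Defs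
begin

text \<open>
  Write $\alpha = a^\ell$, $\gamma = c^\ell$. The vectors
  $u_{ij} = \alpha^{n-i}\gamma^i \otimes a^{m-j}c^j$ are eigenvectors of the torus character
  $a \mapsto t$, $d \mapsto t^{-1}$ with weights $t^{\ell n + m - 2(\ell i + j)}$, which are pairwise
  distinct because $j \le m < \ell$. Hence a subcomodule $M \ne 0$ is spanned by the $u_{ij}$ it
  contains, and it contains $u_{i'j'}$ together with $u_{ij}$ as soon as the coefficient of
  $u_{i'j'}$ in the coaction of $u_{ij}$ is nonzero. The coefficient of $u_{00}$ in the coaction of
  $u_{ij}$ is $\alpha^{n-i}\gamma^i a^{m-j}c^j$. The coefficient of $u_{ij}$ in the coaction of
  $u_{00}$ is $b^{\ell i}$ and $b^j$ times powers of $a$, times a binomial coefficient and a Gaussian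
  binomial coefficient at $q^{-2}$; the latter does not vanish because $m < \ell$. Such monomials are
  nonzero in the algebra since $a$ can act on functions by the dilation $f(z) \mapsto f(qz)$ and one
  of $b$, $c$ by multiplication with $z$.
\<close>

subsection \<open>Gaussian binomial coefficients\<close>

text \<open>The quotient of q-factorials can become zero over zero at roots of unity. The q-Pascal
  recursion makes sense for every \<open>Q\<close>; below it is evaluated both at
  \<open>Q = 1\<close> and at roots of unity.\<close>

fun gauss_binom :: "'a::comm_ring_1 \<Rightarrow> nat \<Rightarrow> nat \<Rightarrow> 'a"
  where
    "gauss_binom Q n 0 = 1"
  | "gauss_binom Q 0 (Suc k) = 0"
  | "gauss_binom Q (Suc n) (Suc k) = gauss_binom Q n k + Q ^ Suc k * gauss_binom Q n (Suc k)"

lemma gauss_binom_eq_0: "n < k \<Longrightarrow> gauss_binom Q n k = 0"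
  by (induction Q n k rule: gauss_binom.induct) auto

lemma gauss_binom_same: "gauss_binom Q n n = 1"
  by (induction n) (auto simp: gauss_binom_eq_0)

lemma gauss_binom_one: "gauss_binom 1 n k = of_nat (n choose k)"
  by (induction "1 :: 'a" n k rule: gauss_binom.induct) auto

text \<open>The q-analogue of (k+1) binom(n+1,k+1) = (n+1) binom(n,k), with denominators cleared so
  that it survives at roots of unity. It decides where Gaussian binomials vanish.\<close>

lemma gauss_binom_absorb:
  "(1 - Q ^ Suc k) * gauss_binom Q (Suc n) (Suc k) = (1 - Q ^ Suc n) * gauss_binom Q n k"
proof (induction n arbitrary: k)
  case 0
  then show ?case by (cases k) auto
next
  case (Suc n)
  let ?g = "gauss_binom Q"
  \<comment> \<open>Once the induction hypothesis is applied, this turns the second q-Pascal term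
    into a multiple of \<open>?g (Suc n) k\<close> too. The factors then add up: \<open>(1 - Q ^ Suc
    k) + Q * (Q ^ k - Q ^ Suc n) = 1 - Q ^ Suc (Suc n)\<close>.\<close>
  have *: "Q ^ k * ((1 - Q ^ Suc n) * ?g n k) = (Q ^ k - Q ^ Suc n) * ?g (Suc n) k"
  proof (cases k)
    case (Suc j)
    have "Q ^ k * ?g n k = ?g (Suc n) k - ?g n j"
      by (simp add: Suc)
    then have "Q ^ k * ((1 - Q ^ Suc n) * ?g n k) = (1 - Q ^ Suc n) * ?g (Suc n) k - (1 - Q ^ Suc n) * ?g n j"
      by (metis (no_types, lifting) mult.left_commute right_diff_distrib)
    also have "(1 - Q ^ Suc n) * ?g n j = (1 - Q ^ k) * ?g (Suc n) k"
      using Suc.IH[of j] Suc by simp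
    finally show ?thesis by (simp add: left_diff_distrib)
  qed simp
  have "(1 - Q ^ Suc k) * ?g (Suc (Suc n)) (Suc k) =
      (1 - Q ^ Suc k) * ?g (Suc n) k + Q ^ Suc k * ((1 - Q ^ Suc k) * ?g (Suc n) (Suc k))"
    by (simp only: gauss_binom.simps) (simp only: algebra_simps)
  also have "\<dots> = (1 - Q ^ Suc k) * ?g (Suc n) k + Q * (Q ^ k * ((1 - Q ^ Suc n) * ?g n k))"
    unfolding Suc.IH by (simp add: mult.assoc)
  also have "\<dots> = (1 - Q ^ Suc (Suc n)) * ?g (Suc n) k"
    unfolding * by (simp add: algebra_simps)
  finally show ?case .
qed

text \<open>On the right of \<open>gauss_binom_absorb\<close> stand two nonzero factors, the second
  by induction, so the left side cannot vanish.\<close>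

lemma gauss_binom_nonzero:
  fixes Q :: "'a::idom"
  assumes "\<And>i. 0 < i \<Longrightarrow> i \<le> n \<Longrightarrow> Q ^ i \<noteq> 1" "k \<le> n"
  shows "gauss_binom Q n k \<noteq> 0"
  using assms
proof (induction n arbitrary: k)
  case (Suc n)
  show ?case
  proof (cases k)
    case (Suc j)
    have "(1 - Q ^ Suc n) * gauss_binom Q n j \<noteq> 0"
      using Suc.IH[of j] Suc.prems Suc by fastforce
    then show ?thesis
      using gauss_binom_absorb[of Q j n] Suc by (metis mult_zero_right)
  qed simp
qed simp

text \<open>In \<open>gauss_binom_absorb\<close> the factor \<open>1 - Q ^ n\<close> is zero while
  \<open>1 - Q ^ k\<close> is not.\<close>

lemma gauss_binom_root_of_unity:
  fixes Q :: "'a::idom"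
  assumes "Q ^ n = 1" "\<And>i. 0 < i \<Longrightarrow> i < n \<Longrightarrow> Q ^ i \<noteq> 1" "0 < k" "k < n"
  shows "gauss_binom Q n k = 0"
proof -
  obtain j p where jp: "k = Suc j" "n = Suc p"
    using assms(3,4) by (metis gr0_conv_Suc less_zeroE not_gr_zero)
  then show ?thesis
    using gauss_binom_absorb[of Q j p] assms by fastforce
qed

section \<open>Elements that commute up to a scalar, and the q-binomial theorem\<close>

lemma q_commute_power:
  fixes x y :: "'b::complex_algebra_1"
  assumes "y * x = r *\<^sub>C (x * y)"
  shows "y ^ i * x ^ j = r ^ (i * j) *\<^sub>C (x ^ j * y ^ i)"
proof -
  have 1: "y ^ i * x = r ^ i *\<^sub>C (x * y ^ i)" for i
  proof (induction i)
    case (Suc i)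
    have "y ^ Suc i * x = y * (y ^ i * x)"
      by (simp add: mult.assoc)
    also have "\<dots> = r ^ i *\<^sub>C ((y * x) * y ^ i)"
      by (simp add: Suc mult_scaleC_right mult.assoc)
    finally show ?case
      by (simp add: assms mult_scaleC_left scaleC_scaleC mult.assoc mult.commute)
  qed (simp add: scaleC_one)
  show ?thesis
  proof (induction j)
    case (Suc j)
    have "y ^ i * x ^ Suc j = (y ^ i * x) * x ^ j"
      by (simp add: mult.assoc)
    also have "\<dots> = r ^ i *\<^sub>C (x * (y ^ i * x ^ j))"
      by (simp add: 1 mult_scaleC_left mult.assoc)
    finally show ?case
      by (simp add: Suc mult_scaleC_right scaleC_scaleC power_add mult.assoc)
  qed (simp add: scaleC_one)
qed

text \<open>The new factor \<open>x + y\<close> is multiplied on from the right. Pulling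
  \<open>x\<close> to the left of \<open>y ^ k\<close> costs \<open>Q ^ k\<close>, which is the
  weight in the q-Pascal rule.\<close>

lemma q_binomial:
  fixes x y :: "'b::complex_algebra_1"
  assumes "y * x = Q *\<^sub>C (x * y)"
  shows "(x + y) ^ n = (\<Sum>k\<le>n. gauss_binom Q n k *\<^sub>C (x ^ (n - k) * y ^ k))"
proof (induction n)
  case (Suc n)
  let ?g = "gauss_binom Q"
  let ?f = "\<lambda>k. (Q ^ k * ?g n k) *\<^sub>C (x ^ (Suc n - k) * y ^ k)"
  have "(x ^ (n - k) * y ^ k) * x = Q ^ k *\<^sub>C (x ^ (Suc n - k) * y ^ k)" if "k \<le> n" for k
    using q_commute_power[OF assms, of k 1] that
    by (simp add: mult.assoc mult_scaleC_right Suc_diff_le power_commutes)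
       (simp flip: mult.assoc add: power_commutes)
  then have 1: "(\<Sum>k\<le>n. ?g n k *\<^sub>C (x ^ (n - k) * y ^ k)) * x = (\<Sum>k\<le>n. ?f k)"
    by (auto simp: sum_distrib_right mult_scaleC_left scaleC_scaleC mult.commute intro!: sum.cong)
  have 2: "(\<Sum>k\<le>n. ?g n k *\<^sub>C (x ^ (n - k) * y ^ k)) * y = (\<Sum>k\<le>n. ?g n k *\<^sub>C (x ^ (n - k) * y ^ Suc k))"
    by (simp add: sum_distrib_right mult_scaleC_left mult.assoc power_commutes)
  \<comment> \<open>The added term is zero. With it the index can be shifted, so that both sums run
    over the same monomials.\<close>
  have "(\<Sum>k\<le>n. ?f k) = (\<Sum>k\<le>Suc n. ?f k)"
    by (simp add: gauss_binom_eq_0)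
  also have "\<dots> = x ^ Suc n + (\<Sum>k\<le>n. ?f (Suc k))"
    unfolding sum.atMost_Suc_shift by (simp add: scaleC_one)
  finally have "(x + y) ^ Suc n = x ^ Suc n + (\<Sum>k\<le>n. ?f (Suc k) + ?g n k *\<^sub>C (x ^ (n - k) * y ^ Suc k))"
    unfolding power_Suc2 Suc distrib_left 1 2 by (simp add: sum.distrib)
  also have "\<dots> = (\<Sum>k\<le>Suc n. ?g (Suc n) k *\<^sub>C (x ^ (Suc n - k) * y ^ k))"
    unfolding sum.atMost_Suc_shift
    by (simp add: scaleC_one scaleC_add_left add.commute)
  finally show ?case .
qed (simp add: scaleC_one)

subsection \<open>Representations of the algebra by dilations and multiplications\<close>

lemma root_q_power_eq_1_iff: "root_q TYPE('l) ^ i = 1 \<longleftrightarrow> CARD('l) dvd i" if "CARD('l) \<noteq> 0"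
proof -
  have "root_q TYPE('l) ^ i = exp (2 * of_real pi * \<i> * of_nat i / of_nat CARD('l))"
    unfolding root_q_def by (simp add: exp_of_nat_mult[symmetric] mult_ac)
  then show ?thesis
    using complex_root_unity_eq_1[of "CARD('l)" i] that by simp
qed

text \<open>A representative is evaluated in the free algebra, and \<open>slq2_eq_lift\<close> makes
  the value independent of the choice. The characters and operator representations below are
  obtained from this.\<close>

lemma slq2_universal_property:
  fixes h :: "gen \<Rightarrow> 'b::complex_algebra_1"
  assumes "\<And>r. r \<in> slq2_relations (root_q TYPE('l)) \<Longrightarrow> free_lift h r = 0"
  shows "\<exists>f :: 'l slq2 \<Rightarrow> 'b. algebra_hom f \<and> (\<forall>g. f (slq2_gen g) = h g)"
proof (intro exI conjI allI)
  define f where "f = (\<lambda>x :: 'l slq2. free_lift h (rep_slq2 x))"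
  have f: "f (abs_slq2 p) = free_lift h p" for p
    unfolding f_def
    by (rule slq2_eq_lift[OF assms]) (auto intro: Quotient3_rep_abs[OF Quotient3_slq2] slq2_eq_refl)
  have abs: "\<exists>p. x = abs_slq2 p" for x :: "'l slq2"
    by (metis Quotient3_abs_rep[OF Quotient3_slq2])
  show "algebra_hom f"
    unfolding algebra_hom_def
  proof (intro conjI allI clinearI)
    fix x y :: "'l slq2" and r
    obtain p p' where "x = abs_slq2 p" "y = abs_slq2 p'"
      using abs by blast
    then show "f (x + y) = f x + f y" "f (r *\<^sub>C x) = r *\<^sub>C f x" "f (x * y) = f x * f y"
      by (simp_all add: plus_slq2.abs_eq scaleC_slq2.abs_eq times_slq2.abs_eq f free_lift_mult
        clinear_add[OF clinear_free_lift] clinear_scale[OF clinear_free_lift])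
  qed (simp add: one_slq2_def f)
  show "f (slq2_gen g) = h g" for g
    by (simp add: slq2_gen.abs_eq f)
qed

text \<open>Linear operators on functions form a type of their own so that they can be an instance
  of \<open>complex_algebra_1\<close> and hence a target of the universal property. Linearity is
  what makes composition respect sums and scalars in its right argument.\<close>

typedef lin_op = "{T :: (complex \<Rightarrow> complex) \<Rightarrow> complex \<Rightarrow> complex.
    \<forall>f g r s. T (\<lambda>z. r * f z + s * g z) = (\<lambda>z. r * T f z + s * T g z)}"
  morphisms apply_op Abs_lin_op
  by (rule exI[of _ "\<lambda>f. f"]) simp

setup_lifting type_definition_lin_op

instantiation lin_op :: complex_algebra_1
begin
lift_definition zero_lin_op :: lin_op is "\<lambda>f z. 0" by simp
lift_definition one_lin_op :: lin_op is "\<lambda>f. f" by simp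
lift_definition plus_lin_op :: "lin_op \<Rightarrow> lin_op \<Rightarrow> lin_op" is "\<lambda>S T f z. S f z + T f z"
  by (simp add: algebra_simps)
lift_definition uminus_lin_op :: "lin_op \<Rightarrow> lin_op" is "\<lambda>T f z. - T f z"
  by simp
lift_definition minus_lin_op :: "lin_op \<Rightarrow> lin_op \<Rightarrow> lin_op" is "\<lambda>S T f z. S f z - T f z"
  by (simp add: algebra_simps)
lift_definition scaleC_lin_op :: "complex \<Rightarrow> lin_op \<Rightarrow> lin_op" is "\<lambda>c T f z. c * T f z"
  by (simp add: algebra_simps)
lift_definition times_lin_op :: "lin_op \<Rightarrow> lin_op \<Rightarrow> lin_op" is "\<lambda>S T f. S (T f)"
  by simp
instance
proof
  fix r :: complex and S T R :: lin_op
  have lin: "apply_op R (\<lambda>z. f z + g z) = (\<lambda>z. apply_op R f z + apply_op R g z)"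
    "apply_op R (\<lambda>z. r * f z) = (\<lambda>z. r * apply_op R f z)" for f g
    using apply_op[of R, simplified, rule_format, of 1 f 1 g]
      apply_op[of R, simplified, rule_format, of r f 0 f] by simp_all
  show "R * (S + T) = R * S + R * T" "R * (r *\<^sub>C T) = r *\<^sub>C (R * T)"
    using lin by (simp_all add: apply_op_inject[symmetric] times_lin_op.rep_eq plus_lin_op.rep_eq scaleC_lin_op.rep_eq fun_eq_iff)
  show "(0 :: lin_op) \<noteq> 1"
    by transfer (metis zero_neq_one)
qed (transfer; simp add: algebra_simps fun_eq_iff)+
end

lift_definition dilation_op :: "complex \<Rightarrow> lin_op" is "\<lambda>q f z. f (q * z)"
  by simp

lift_definition coord_op :: lin_op is "\<lambda>f z. z * f z"
  by (simp add: algebra_simps)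

lemma apply_dilation_power: "apply_op (dilation_op q ^ n) f z = f (q ^ n * z)"
  by (induction n arbitrary: z)
     (simp_all add: one_lin_op.rep_eq times_lin_op.rep_eq dilation_op.rep_eq mult_ac)

lemma apply_coord_power: "apply_op (coord_op ^ n) f z = z ^ n * f z"
  by (induction n) (simp_all add: one_lin_op.rep_eq times_lin_op.rep_eq coord_op.rep_eq)

text \<open>With the dilation by \<open>q\<close> for \<open>a\<close> and its inverse for
  \<open>d\<close>, these are the q-commutation relations of \<open>a\<close> and \<open>d\<close>
  with \<open>b\<close> or \<open>c\<close>.\<close>

lemma dilation_coord:
  "dilation_op q * coord_op = q *\<^sub>C (coord_op * dilation_op q)"
  "q \<noteq> 0 \<Longrightarrow> coord_op * dilation_op (inverse q) = q *\<^sub>C (dilation_op (inverse q) * coord_op)"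
  by (transfer; simp add: fun_eq_iff)+

lemma dilation_inverse:
  "q \<noteq> 0 \<Longrightarrow> dilation_op q * dilation_op (inverse q) = 1"
  "q \<noteq> 0 \<Longrightarrow> dilation_op (inverse q) * dilation_op q = 1"
  by (transfer; simp add: fun_eq_iff mult.assoc[symmetric])+

subsection \<open>Linear algebra\<close>

lemma clinear_sum: "clinear f \<Longrightarrow> f (\<Sum>i\<in>I. x i) = (\<Sum>i\<in>I. f (x i))"
  by (induction I rule: infinite_finite_induct) (auto simp: clinear_zero clinear_add)

lemma clinear_eq_on_span:
  assumes "clinear f" "clinear g" "\<And>x. x \<in> S \<Longrightarrow> f x = g x" "x \<in> cspan S"
  shows "f x = g x"
  using assms(4)
  by (induction rule: complex_vector.span_induct_alt)
     (simp_all add: clinear_zero clinear_add clinear_scale assms(1-3))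

lemma clinear_mem_on_span:
  assumes "clinear f" "csubspace M" "\<And>x. x \<in> S \<Longrightarrow> f x \<in> M" "x \<in> cspan S"
  shows "f x \<in> M"
  using assms(4)
proof (induction rule: complex_vector.span_induct_alt)
  case base
  show ?case by (simp add: clinear_zero[OF assms(1)] complex_vector.subspace_0[OF assms(2)])
next
  case (step r x y)
  then show ?case
    by (simp add: clinear_add[OF assms(1)] clinear_scale[OF assms(1)] assms(3)
        complex_vector.subspace_add[OF assms(2)] complex_vector.subspace_scale[OF assms(2)])
qed

lemma cbilinear_mem_on_span:
  assumes "cbilinear f" "csubspace M" "\<And>x y. x \<in> S \<Longrightarrow> y \<in> T \<Longrightarrow> f x y \<in> M"
    and "x \<in> cspan S" "y \<in> cspan T"
  shows "f x y \<in> M"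
proof (rule clinear_mem_on_span[OF _ assms(2) _ assms(4)])
  show "clinear (\<lambda>x. f x y)"
    using assms(1) by (simp add: cbilinear_def)
  have "clinear (f x)" for x
    using assms(1) by (simp add: cbilinear_def)
  then show "f x y \<in> M" if "x \<in> S" for x
    by (rule clinear_mem_on_span[OF _ assms(2) assms(3)[OF that] assms(5)])
qed

lemma csubspace_cspan: "csubspace (cspan S)"
  by (rule complex_vector.subspace_span)

lemma clinear_id: "clinear id"
  by (rule clinearI) auto

lemma clinear_compose: "clinear f \<Longrightarrow> clinear g \<Longrightarrow> clinear (\<lambda>x. f (g x))"
  by (rule clinearI) (auto simp: clinear_add clinear_scale)

lemma cspan_image_finite:
  assumes "finite I" "x \<in> cspan (w ` I)"
  obtains f where "x = (\<Sum>i\<in>I. f i *\<^sub>C w i)"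
proof -
  have "\<exists>f. x = (\<Sum>i\<in>I. f i *\<^sub>C w i)"
    using assms(2)
  proof (induction rule: complex_vector.span_induct_alt)
    case base
    show ?case by (rule exI[of _ "\<lambda>_. 0"]) simp
  next
    case (step r s y)
    then obtain i f where if': "i \<in> I" "s = w i" "y = (\<Sum>i\<in>I. f i *\<^sub>C w i)"
      by auto
    have "r *\<^sub>C s + y = (\<Sum>k\<in>I. (if k = i then r *\<^sub>C w k else 0) + f k *\<^sub>C w k)"
      using if' assms(1) by (simp add: sum.distrib)
    also have "\<dots> = (\<Sum>k\<in>I. ((if k = i then r else 0) + f k) *\<^sub>C w k)"
      by (intro sum.cong) (auto simp: scaleC_add_left)
    finally show ?case
      by (rule exI[of _ "\<lambda>k. (if k = i then r else 0) + f k"])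
  qed
  then show ?thesis using that by blast
qed

text \<open>Applying \<open>T - r k\<close> to the sum kills the summand \<open>x k\<close> and
  multiplies every other \<open>x i\<close> by the nonzero number \<open>r i - r k\<close>; this
  leaves a shorter sum for the induction.\<close>

lemma eigenvector_components:
  assumes "csubspace M" "clinear T" "\<And>x. x \<in> M \<Longrightarrow> T x \<in> M"
    and "finite I" "inj_on r I" "\<And>i. i \<in> I \<Longrightarrow> T (x i) = r i *\<^sub>C x i"
    and "(\<Sum>i\<in>I. x i) \<in> M" "i \<in> I"
  shows "x i \<in> M"
  using assms(4-8)
proof (induction I arbitrary: x i rule: finite_induct)
  case (insert k I)
  have "T (\<Sum>i\<in>insert k I. x i) - r k *\<^sub>C (\<Sum>i\<in>insert k I. x i) \<in> M"
    using insert.prems(3) assms(1-3)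
    by (intro complex_vector.subspace_diff complex_vector.subspace_scale) auto
  also have "T (\<Sum>i\<in>insert k I. x i) - r k *\<^sub>C (\<Sum>i\<in>insert k I. x i) = (\<Sum>i\<in>I. (r i - r k) *\<^sub>C x i)"
    using insert.hyps insert.prems(2)
    by (simp add: clinear_sum[OF assms(2)] clinear_add[OF assms(2)] complex_vector.scale_left_diff_distrib
       scaleC_add_right complex_vector.scale_sum_right sum_subtractf)
  \<comment> \<open>The induction hypothesis is used for the rescaled eigenvectors, which have the
    same eigenvalues.\<close>
  finally have "(r i - r k) *\<^sub>C x i \<in> M" if "i \<in> I" for i
    using insert.IH[of "\<lambda>i. (r i - r k) *\<^sub>C x i" i] insert.prems(1,2) that
    by (simp add: clinear_scale[OF assms(2)] scaleC_scaleC mult.commute)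
  moreover have "r i - r k \<noteq> 0" if "i \<in> I" for i
    using insert.prems(1) insert.hyps(2) that by (auto simp: inj_on_def)
  ultimately have *: "x i \<in> M" if "i \<in> I" for i
    using that complex_vector.subspace_scale[OF assms(1), of "(r i - r k) *\<^sub>C x i" "inverse (r i - r k)"]
    by (simp add: scaleC_scaleC scaleC_one)
  moreover have "x k = (\<Sum>i\<in>insert k I. x i) - (\<Sum>i\<in>I. x i)"
    using insert.hyps by simp
  then have "x k \<in> M"
    using insert.prems(3) * assms(1)
    by (metis complex_vector.subspace_diff complex_vector.subspace_sum)
  ultimately show ?case
    using insert.prems(4) by auto
qed simp

section \<open>Linear maps and subspaces of tensor products\<close>

lemma tensor_map_of: "clinear f \<Longrightarrow> clinear g \<Longrightarrow> tensor_map f g (x \<otimes>\<^sub>c y) = f x \<otimes>\<^sub>c g y"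
  by (simp add: tensor_map_def tensor_lift_of cbilinear_tensor_map)

lemma clinear_tensor_map: "clinear f \<Longrightarrow> clinear g \<Longrightarrow> clinear (tensor_map f g)"
  by (simp add: tensor_map_def[abs_def] clinear_tensor_lift cbilinear_tensor_map)

lemma clinear_tensor_assoc: "clinear tensor_assoc"
  unfolding tensor_assoc_def by (rule clinear_tensor_lift[OF cbilinear_tensor_assoc(2)])

lemma tensor_space_cspan:
  "tensor_space (cspan S) (cspan T) = cspan {s \<otimes>\<^sub>c t | s t. s \<in> S \<and> t \<in> T}"
proof
  show "tensor_space (cspan S) (cspan T) \<subseteq> cspan {s \<otimes>\<^sub>c t | s t. s \<in> S \<and> t \<in> T}"
    unfolding tensor_space_def
  proof (rule complex_vector.span_minimal[OF _ csubspace_cspan], clarify)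
    fix u v assume "u \<in> cspan S" "v \<in> cspan T"
    then show "u \<otimes>\<^sub>c v \<in> cspan {s \<otimes>\<^sub>c t | s t. s \<in> S \<and> t \<in> T}"
      by (rule cbilinear_mem_on_span[OF cbilinear_tensor_of csubspace_cspan, rotated])
         (auto intro: complex_vector.span_base)
  qed
  show "cspan {s \<otimes>\<^sub>c t | s t. s \<in> S \<and> t \<in> T} \<subseteq> tensor_space (cspan S) (cspan T)"
    unfolding tensor_space_def by (intro complex_vector.span_mono) (auto intro: complex_vector.span_base)
qed

lemma tensor_of_mem_tensor_space: "u \<in> U \<Longrightarrow> v \<in> V \<Longrightarrow> u \<otimes>\<^sub>c v \<in> tensor_space U V"
  unfolding tensor_space_def by (blast intro: complex_vector.span_base)

lemma csubspace_tensor_space: "csubspace (tensor_space U V)"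
  unfolding tensor_space_def by (rule csubspace_cspan)

subsection \<open>Tensor products of comodules\<close>

text \<open>This is \<phi> tensor id, with C tensor V identified with V. Composed with a coaction it
  lets functionals on the algebra act on a comodule, and by \<open>slice_mem\<close> every
  subcomodule is stable under this action.\<close>

definition slice :: "('a::complex_vector \<Rightarrow> complex) \<Rightarrow> 'a \<otimes>\<^sub>c 'b \<Rightarrow> 'b::complex_vector"
  where "slice \<phi> = tensor_lift (\<lambda>x v. \<phi> x *\<^sub>C v)"

lemma cbilinear_slice: "clinear \<phi> \<Longrightarrow> cbilinear (\<lambda>x v. \<phi> x *\<^sub>C v)"
  by (rule cbilinearI)
     (simp_all add: clinear_add clinear_scale scaleC_add_left scaleC_add_right
        scaleC_scaleC scaleC_complex_def mult.commute)

lemma slice_of: "clinear \<phi> \<Longrightarrow> slice \<phi> (x \<otimes>\<^sub>c v) = \<phi> x *\<^sub>C v"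
  by (simp add: slice_def tensor_lift_of cbilinear_slice)

lemma clinear_slice: "clinear \<phi> \<Longrightarrow> clinear (slice \<phi>)"
  by (simp add: slice_def[abs_def] clinear_tensor_lift cbilinear_slice)

lemma slice_mem:
  assumes "clinear \<phi>" "csubspace M" "t \<in> tensor_space UNIV M"
  shows "slice \<phi> t \<in> M"
  by (rule clinear_mem_on_span[OF clinear_slice[OF assms(1)] assms(2) _ assms(3)[unfolded tensor_space_def]])
     (auto simp: slice_of assms(1) intro: complex_vector.subspace_scale[OF assms(2)])

text \<open>The part of \<open>tensor_coaction\<close> that remains after both coactions have been
  applied. Isolating it gives a map that is bilinear in the two coaction values and free of \<delta>
  and \<delta>'.\<close>

definition leg_mult :: "'a::complex_algebra_1 \<otimes>\<^sub>c 'u::complex_vector \<Rightarrow> 'a \<otimes>\<^sub>c 'v::complex_vector \<Rightarrow> 'a \<otimes>\<^sub>c 'u \<otimes>\<^sub>c 'v"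
  where "leg_mult s t = tensor_lift (\<lambda>x u. tensor_lift (\<lambda>y v. (x * y) \<otimes>\<^sub>c (u \<otimes>\<^sub>c v)) t) s"

lemma cbilinear_leg_mult: "cbilinear (leg_mult :: 'a::complex_algebra_1 \<otimes>\<^sub>c 'u::complex_vector \<Rightarrow> 'a \<otimes>\<^sub>c 'v::complex_vector \<Rightarrow> _)"
  and leg_mult_of: "leg_mult ((x :: 'a) \<otimes>\<^sub>c (u :: 'u)) (y \<otimes>\<^sub>c (v :: 'v)) = (x * y) \<otimes>\<^sub>c (u \<otimes>\<^sub>c v)"
proof -
  note simps = distrib_left distrib_right mult_scaleC_left mult_scaleC_right
    cbilinear_simps[OF cbilinear_tensor_of] tensor_lift_fun_add tensor_lift_fun_scale
  have inner: "cbilinear (\<lambda>y v. (x * y) \<otimes>\<^sub>c (u \<otimes>\<^sub>c v))" for x :: 'a and u :: 'u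
    by (rule cbilinearI) (simp_all add: simps)
  have outer: "cbilinear (\<lambda>x u. tensor_lift (\<lambda>y v. (x * y) \<otimes>\<^sub>c (u \<otimes>\<^sub>c v)) t)" for t :: "'a \<otimes>\<^sub>c 'v"
    by (rule cbilinearI) (simp_all add: simps)
  show "cbilinear (leg_mult :: 'a \<otimes>\<^sub>c 'u \<Rightarrow> 'a \<otimes>\<^sub>c 'v \<Rightarrow> _)"
    by (rule cbilinearI)
       (simp_all add: leg_mult_def simps clinear_add[OF clinear_tensor_lift[OF outer]]
          clinear_scale[OF clinear_tensor_lift[OF outer]] clinear_add[OF clinear_tensor_lift[OF inner]]
          clinear_scale[OF clinear_tensor_lift[OF inner]])
  show "leg_mult (x \<otimes>\<^sub>c u) (y \<otimes>\<^sub>c v) = (x * y) \<otimes>\<^sub>c (u \<otimes>\<^sub>c v)"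
    by (subst leg_mult_def, subst tensor_lift_of[OF outer], rule tensor_lift_of[OF inner])
qed

lemma leg_mult_zero: "leg_mult 0 t = 0" "leg_mult s 0 = 0"
  using cbilinear_simps(2)[OF cbilinear_leg_mult, of 0 0 t] cbilinear_simps(4)[OF cbilinear_leg_mult, of s 0 0]
  by simp_all

lemma cbilinear_tensor_coaction:
  "clinear \<delta> \<Longrightarrow> clinear \<delta>' \<Longrightarrow> cbilinear (\<lambda>u v. leg_mult (\<delta> u) (\<delta>' v))"
  by (rule cbilinearI) (simp_all add: clinear_add clinear_scale cbilinear_simps[OF cbilinear_leg_mult])

lemma tensor_coaction_eq: "tensor_coaction \<delta> \<delta>' = tensor_lift (\<lambda>u v. leg_mult (\<delta> u) (\<delta>' v))"
  by (simp add: tensor_coaction_def leg_mult_def)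

lemma clinear_tensor_coaction: "clinear \<delta> \<Longrightarrow> clinear \<delta>' \<Longrightarrow> clinear (tensor_coaction \<delta> \<delta>')"
  unfolding tensor_coaction_eq by (intro clinear_tensor_lift cbilinear_tensor_coaction)

lemma tensor_coaction_of:
  "clinear \<delta> \<Longrightarrow> clinear \<delta>' \<Longrightarrow> tensor_coaction \<delta> \<delta>' (u \<otimes>\<^sub>c v) = leg_mult (\<delta> u) (\<delta>' v)"
  unfolding tensor_coaction_eq by (intro tensor_lift_of cbilinear_tensor_coaction)

lemma leg_mult_mem:
  assumes "s \<in> tensor_space UNIV U" "t \<in> tensor_space UNIV V"
  shows "leg_mult s t \<in> tensor_space UNIV (tensor_space U V)"
  by (rule cbilinear_mem_on_span[OF cbilinear_leg_mult csubspace_tensor_space _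
        assms(1)[unfolded tensor_space_def] assms(2)[unfolded tensor_space_def]])
     (auto simp: leg_mult_of intro!: tensor_of_mem_tensor_space)

text \<open>A character is multiplicative, so it acts on a tensor product diagonally, like a group
  element.\<close>

lemma slice_leg_mult:
  assumes "algebra_hom \<phi>"
  shows "slice \<phi> (leg_mult s t) = slice \<phi> s \<otimes>\<^sub>c slice \<phi> t"
proof -
  have lin: "clinear \<phi>" and mult: "\<phi> (x * y) = \<phi> x * \<phi> y" for x y
    using assms by (auto simp: algebra_hom_def)
  note simps = clinear_zero[OF clinear_slice[OF lin]] clinear_add[OF clinear_slice[OF lin]]
     cbilinear_simps[OF cbilinear_leg_mult] cbilinear_simps[OF cbilinear_tensor_of] leg_mult_zero
  show ?thesis
  proof (induction s)
    case (of x u)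
    show ?case
      by (induction t) (simp_all add: simps leg_mult_of slice_of lin mult scaleC_scaleC mult.commute)
  qed (simp_all add: simps)
qed

text \<open>Here \<open>s\<close> and \<open>t\<close> stand for \<open>\<delta> u\<close> and
  \<open>\<delta>' v\<close>. Coassociativity is assumed for these two tensors alone, since a
  comodule satisfies it only on its subspace.\<close>

lemma tensor_coaction_coassoc:
  fixes s :: "'l slq2 \<otimes>\<^sub>c 'u::complex_vector" and t :: "'l slq2 \<otimes>\<^sub>c 'v::complex_vector"
  assumes lin: "clinear \<delta>" "clinear \<delta>'"
    and s: "tensor_assoc (tensor_map comult id s) = tensor_map id \<delta> s"
    and t: "tensor_assoc (tensor_map comult id t) = tensor_map id \<delta>' t"
  shows "tensor_assoc (tensor_map comult id (leg_mult s t)) =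
    tensor_map id (tensor_coaction \<delta> \<delta>') (leg_mult s t)"
proof -
  have comult: "clinear comult" "comult (x * y) = comult x * comult y" for x y :: "'l slq2"
    using algebra_hom_comult by (auto simp: algebra_hom_def)
  note lins = comult(1) lin clinear_id clinear_tensor_coaction[OF lin] clinear_tensor_lift[OF cbilinear_leg_mult]
  \<comment> \<open>\<open>F\<close> multiplies the second algebra legs. A coassociated pair is
    first joined by \<open>leg_mult\<close> along the outer legs, which leaves a pair of inner
    tensors for \<open>F\<close> to join.\<close>
  define F where
    "F = tensor_map (id :: 'l slq2 \<Rightarrow> _)
      (tensor_lift leg_mult :: ('l slq2 \<otimes>\<^sub>c 'u) \<otimes>\<^sub>c ('l slq2 \<otimes>\<^sub>c 'v) \<Rightarrow> 'l slq2 \<otimes>\<^sub>c 'u \<otimes>\<^sub>c 'v)"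
  have F: "clinear F" "F (x \<otimes>\<^sub>c w) = x \<otimes>\<^sub>c tensor_lift leg_mult w" for x w
    unfolding F_def by (simp_all only: clinear_tensor_map lins tensor_map_of id_apply)
  note maps = F(1) lins(1-3,5,6) clinear_tensor_map[OF lins(1,4)] clinear_tensor_map[OF lins(4,2)]
    clinear_tensor_map[OF lins(4,3)] clinear_tensor_map[OF lins(4,5)] clinear_tensor_assoc
  note rules = maps[THEN clinear_zero] maps[THEN clinear_add]
     cbilinear_simps(1,3)[OF cbilinear_leg_mult] cbilinear_simps(1,3)[OF cbilinear_tensor_of] leg_mult_zero
     tensor_map_of[OF lins(1,4)] tensor_map_of[OF lins(4,2)] tensor_map_of[OF lins(4,3)]
     tensor_map_of[OF lins(4,5)] F(2)
     leg_mult_of tensor_assoc_of tensor_coaction_of[OF lin]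
     tensor_lift_of[OF cbilinear_leg_mult] distrib_left distrib_right tensor_times_of
  note simps = rules[unfolded id_def]
  \<comment> \<open>The product of \<open>p\<close> and \<open>r\<close> is taken leg by leg, so the
    legs may also be regrouped first and multiplied afterwards.\<close>
  have assoc: "tensor_assoc ((p * r) \<otimes>\<^sub>c (u \<otimes>\<^sub>c v)) =
      F (leg_mult (tensor_assoc (p \<otimes>\<^sub>c u)) (tensor_assoc (r \<otimes>\<^sub>c v)))"
    for p r :: "'l slq2 \<otimes>\<^sub>c 'l slq2" and u :: 'u and v :: 'v
  proof (induction p)
    case (of x x')
    show ?case
      by (induction r) (simp_all add: id_def simps)
  qed (simp_all add: id_def simps)
  have "tensor_assoc (tensor_map comult id (leg_mult s t)) =
      F (leg_mult (tensor_assoc (tensor_map comult id s)) (tensor_assoc (tensor_map comult id t)))"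
  proof (induction s)
    case (of x u)
    show ?case
      by (induction t) (simp_all add: id_def simps comult(2) assoc)
  qed (simp_all add: id_def simps)
  also have "\<dots> = F (leg_mult (tensor_map id \<delta> s) (tensor_map id \<delta>' t))"
    by (simp add: s t)
  also have "\<dots> = tensor_map id (tensor_coaction \<delta> \<delta>') (leg_mult s t)"
  proof (induction s)
    case (of x u)
    show ?case
      by (induction t) (simp_all add: id_def simps)
  qed (simp_all add: id_def simps)
  finally show ?thesis .
qed

lemma comodule_tensor_space:
  fixes \<delta> :: "'u::complex_vector \<Rightarrow> 'l slq2 \<otimes>\<^sub>c 'u" and \<delta>' :: "'v::complex_vector \<Rightarrow> 'l slq2 \<otimes>\<^sub>c 'v"
  assumes "comodule \<delta> U" "comodule \<delta>' V"
  shows "comodule (tensor_coaction \<delta> \<delta>') (tensor_space U V)"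
proof -
  have lin: "clinear \<delta>" "clinear \<delta>'"
    using assms by (auto simp: comodule_def)
  note clin = clinear_tensor_coaction[OF lin]
  have hom: "algebra_hom (counit :: 'l slq2 \<Rightarrow> _)" "clinear (counit :: 'l slq2 \<Rightarrow> _)"
    and comult: "clinear (comult :: 'l slq2 \<Rightarrow> _)"
    using algebra_hom_counit algebra_hom_comult by (auto simp: algebra_hom_def)
  have "tensor_coaction \<delta> \<delta>' w \<in> tensor_space UNIV (tensor_space U V)"
    if "w \<in> tensor_space U V" for w
    using assms unfolding comodule_def
    by (intro clinear_mem_on_span[OF clin csubspace_tensor_space _ that[unfolded tensor_space_def]])
       (auto simp: tensor_coaction_of lin image_subset_iff intro!: leg_mult_mem)
  moreover have "tensor_assoc (tensor_map comult id (tensor_coaction \<delta> \<delta>' w)) =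
      tensor_map id (tensor_coaction \<delta> \<delta>') (tensor_coaction \<delta> \<delta>' w)"
    if "w \<in> tensor_space U V" for w
  proof (rule clinear_eq_on_span[OF _ _ _ that[unfolded tensor_space_def]])
    show "clinear (\<lambda>w. tensor_assoc (tensor_map comult id (tensor_coaction \<delta> \<delta>' w)))"
      by (rule clinear_compose[OF clinear_tensor_assoc clinear_compose[OF clinear_tensor_map[OF comult clinear_id] clin]])
    show "clinear (\<lambda>w. tensor_map id (tensor_coaction \<delta> \<delta>') (tensor_coaction \<delta> \<delta>' w))"
      by (rule clinear_compose[OF clinear_tensor_map[OF clinear_id clin] clin])
    fix w assume "w \<in> {u \<otimes>\<^sub>c v | u v. u \<in> U \<and> v \<in> V}"
    then obtain u v where w: "w = u \<otimes>\<^sub>c v" "u \<in> U" "v \<in> V" by blast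
    show "tensor_assoc (tensor_map comult id (tensor_coaction \<delta> \<delta>' w)) =
      tensor_map id (tensor_coaction \<delta> \<delta>') (tensor_coaction \<delta> \<delta>' w)"
      unfolding w(1) tensor_coaction_of[OF lin]
      by (rule tensor_coaction_coassoc[OF lin]) (use assms w(2,3) in \<open>simp_all add: comodule_def\<close>)
  qed
  \<comment> \<open>The counit is a character, so \<open>slice_leg_mult\<close> reduces its axiom to
    those of the two factors.\<close>
  moreover have "slice counit (tensor_coaction \<delta> \<delta>' w) = w" if "w \<in> tensor_space U V" for w
  proof (rule clinear_eq_on_span[OF _ _ _ that[unfolded tensor_space_def]])
    show "clinear (\<lambda>w. slice counit (tensor_coaction \<delta> \<delta>' w))"
      by (rule clinear_compose[OF clinear_slice[OF hom(2)] clin])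
    show "clinear (\<lambda>w :: 'u \<otimes>\<^sub>c 'v. w)"
      by (rule clinearI) simp_all
    fix w assume "w \<in> {u \<otimes>\<^sub>c v | u v. u \<in> U \<and> v \<in> V}"
    moreover have "slice counit (\<delta> u) = u" "slice counit (\<delta>' v) = v" if "u \<in> U" "v \<in> V" for u v
      using assms that by (simp_all add: comodule_def slice_def)
    ultimately show "slice counit (tensor_coaction \<delta> \<delta>' w) = w"
      by (auto simp: tensor_coaction_of[OF lin] slice_leg_mult[OF hom(1)])
  qed
  ultimately show ?thesis
    using csubspace_tensor_space clin unfolding comodule_def slice_def by blast
qed

lemma algebra_hom_power: "algebra_hom f \<Longrightarrow> f (x ^ n) = f x ^ n"
  by (induction n) (auto simp: algebra_hom_def)

lemma tensor_of_power: "(x \<otimes>\<^sub>c y) ^ n = (x ^ n) \<otimes>\<^sub>c (y ^ n)"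
  by (induction n) (auto simp: one_tensor_def tensor_times_of)

subsection \<open>Comultiplication of monomials in $a$ and $c$\<close>

lemma comult_simps:
  "comult (x * y) = comult x * comult y" "comult (x ^ n) = comult x ^ n" "comult 1 = 1"
  using algebra_hom_comult algebra_hom_power[OF algebra_hom_comult] by (auto simp: algebra_hom_def)

text \<open>The elements are arbitrary because the lemma serves twice: for the generators, and for
  their l-th powers with \<open>r = 1\<close>. Of the coefficients only the one at
  \<open>k = 0\<close> is made explicit.\<close>

lemma comult_monomial:
  fixes a b c d :: "'l slq2"
  assumes "comult a = a \<otimes>\<^sub>c a + b \<otimes>\<^sub>c c" "comult c = c \<otimes>\<^sub>c a + d \<otimes>\<^sub>c c" "c * a = r *\<^sub>C (a * c)"
  obtains C where "comult (a ^ p * c ^ s) = (\<Sum>k\<le>p + s. C k \<otimes>\<^sub>c (a ^ (p + s - k) * c ^ k))"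
    and "C 0 = a ^ p * c ^ s"
proof -
  let ?v = "\<lambda>m k. a ^ (m - k) * c ^ k"
  \<comment> \<open>One factor of the monomial is split off on the left; \<open>x\<close>,
    \<open>y\<close> will be \<open>a\<close>, \<open>b\<close> or \<open>c\<close>,
    \<open>d\<close>. The term with \<open>a\<close> keeps the index \<open>k\<close> and the term
    with \<open>c\<close> raises it, so index 0 receives \<open>x * C 0\<close> only.\<close>
  have step: "\<exists>C'. (x \<otimes>\<^sub>c a + y \<otimes>\<^sub>c c) * (\<Sum>k\<le>m. C k \<otimes>\<^sub>c ?v m k) = (\<Sum>k\<le>Suc m. C' k \<otimes>\<^sub>c ?v (Suc m) k)
      \<and> C' 0 = x * C 0" for x y and m and C :: "nat \<Rightarrow> 'l slq2"
  proof -
    have "a * ?v m k = ?v (Suc m) k" if "k \<le> m" for k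
      using that by (simp add: Suc_diff_le mult.assoc)
    then have 1: "(x \<otimes>\<^sub>c a) * (\<Sum>k\<le>m. C k \<otimes>\<^sub>c ?v m k) = (\<Sum>k\<le>m. (x * C k) \<otimes>\<^sub>c ?v (Suc m) k)"
      by (simp add: sum_distrib_left tensor_times_of)
    have "c * ?v m k = r ^ (m - k) *\<^sub>C ?v (Suc m) (Suc k)" for k
      using q_commute_power[OF assms(3), of 1 "m - k"]
      by (simp add: mult_scaleC_left mult.assoc[symmetric])
    then have 2: "(y \<otimes>\<^sub>c c) * (\<Sum>k\<le>m. C k \<otimes>\<^sub>c ?v m k) =
        (\<Sum>k\<le>m. (r ^ (m - k) *\<^sub>C (y * C k)) \<otimes>\<^sub>c ?v (Suc m) (Suc k))"
      by (simp add: sum_distrib_left tensor_times_of cbilinear_simps[OF cbilinear_tensor_of])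
    \<comment> \<open>The zeros are the boundary values: the first summand has no term at
      \<open>Suc m\<close>, the shifted one none at 0.\<close>
    define C' where "C' k = (if k \<le> m then x * C k else 0) +
       (case k of 0 \<Rightarrow> 0 | Suc k \<Rightarrow> r ^ (m - k) *\<^sub>C (y * C k))" for k
    have "(\<Sum>k\<le>Suc m. C' k \<otimes>\<^sub>c ?v (Suc m) k) =
      (\<Sum>k\<le>Suc m. (if k \<le> m then x * C k else 0) \<otimes>\<^sub>c ?v (Suc m) k) +
      (\<Sum>k\<le>Suc m. (case k of 0 \<Rightarrow> 0 | Suc k \<Rightarrow> r ^ (m - k) *\<^sub>C (y * C k)) \<otimes>\<^sub>c ?v (Suc m) k)"
      unfolding C'_def cbilinear_simps[OF cbilinear_tensor_of] sum.distrib ..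
    also have "(\<Sum>k\<le>Suc m. (if k \<le> m then x * C k else 0) \<otimes>\<^sub>c ?v (Suc m) k) =
      (\<Sum>k\<le>m. (x * C k) \<otimes>\<^sub>c ?v (Suc m) k)"
      by simp
    also have "(\<Sum>k\<le>Suc m. (case k of 0 \<Rightarrow> 0 | Suc k \<Rightarrow> r ^ (m - k) *\<^sub>C (y * C k)) \<otimes>\<^sub>c ?v (Suc m) k) =
      (\<Sum>k\<le>m. (r ^ (m - k) *\<^sub>C (y * C k)) \<otimes>\<^sub>c ?v (Suc m) (Suc k))"
      unfolding sum.atMost_Suc_shift by simp
    finally show ?thesis
      unfolding distrib_right 1 2 by (intro exI[of _ C']) (simp add: C'_def)
  qed
  have "\<exists>C. comult (c ^ s) = (\<Sum>k\<le>s. C k \<otimes>\<^sub>c ?v s k) \<and> C 0 = c ^ s"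
  proof (induction s)
    case 0
    show ?case by (rule exI[of _ "\<lambda>_. 1"]) (simp add: comult_simps one_tensor_def tensor_times_of)
  next
    case (Suc s)
    then obtain C where C: "comult (c ^ s) = (\<Sum>k\<le>s. C k \<otimes>\<^sub>c ?v s k)" "C 0 = c ^ s"
      by blast
    show ?case
      using step[where x = c and y = d and m = s and C = C] unfolding power_Suc comult_simps(1) assms(2) C .
  qed
  then have "\<exists>C. comult (a ^ p * c ^ s) = (\<Sum>k\<le>p + s. C k \<otimes>\<^sub>c ?v (p + s) k) \<and> C 0 = a ^ p * c ^ s"
  proof (induction p)
    case (Suc p)
    then obtain C where C: "comult (a ^ p * c ^ s) = (\<Sum>k\<le>p + s. C k \<otimes>\<^sub>c ?v (p + s) k)" "C 0 = a ^ p * c ^ s"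
      by blast
    show ?case
      using step[where x = a and y = b and m = "p + s" and C = C] unfolding power_Suc mult.assoc[of a] comult_simps(1)[of a] assms(1) C add_Suc .
  qed simp
  then show ?thesis using that by blast
qed

text \<open>Each of the two legs contributes a factor \<open>r\<close> when the summands are
  interchanged, hence the parameter \<open>r\<^sup>2\<close> in the q-binomial theorem.\<close>

lemma comult_power:
  fixes a b c :: "'l slq2"
  assumes "comult a = a \<otimes>\<^sub>c a + b \<otimes>\<^sub>c c" "c * a = r *\<^sub>C (a * c)" "b * a = r *\<^sub>C (a * b)"
  shows "comult (a ^ n) =
    (\<Sum>k\<le>n. (gauss_binom (r\<^sup>2) n k *\<^sub>C (a ^ (n - k) * b ^ k)) \<otimes>\<^sub>c (a ^ (n - k) * c ^ k))"
proof -
  have "(b \<otimes>\<^sub>c c) * (a \<otimes>\<^sub>c a) = r\<^sup>2 *\<^sub>C ((a \<otimes>\<^sub>c a) * (b \<otimes>\<^sub>c c))"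
    by (simp add: tensor_times_of assms(2,3) cbilinear_simps[OF cbilinear_tensor_of] scaleC_scaleC power2_eq_square)
  from q_binomial[OF this, of n] show ?thesis
    by (simp add: comult_simps assms(1) tensor_of_power tensor_times_of cbilinear_simps[OF cbilinear_tensor_of])
qed

text \<open>At a primitive n-th root of unity all inner Gaussian binomials vanish.\<close>

lemma q_binomial_root_of_unity:
  fixes x y :: "'b::complex_algebra_1"
  assumes "y * x = Q *\<^sub>C (x * y)" "n > 0" "Q ^ n = 1" "\<And>i. 0 < i \<Longrightarrow> i < n \<Longrightarrow> Q ^ i \<noteq> 1"
  shows "(x + y) ^ n = x ^ n + y ^ n"
proof -
  have "(\<Sum>k\<le>n. gauss_binom Q n k *\<^sub>C (x ^ (n - k) * y ^ k)) =
    (\<Sum>k\<in>{0, n}. gauss_binom Q n k *\<^sub>C (x ^ (n - k) * y ^ k))"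
    using gauss_binom_root_of_unity[of Q n] assms(3,4)
    by (intro sum.mono_neutral_right) auto
  then show ?thesis
    unfolding q_binomial[OF assms(1)] using assms(2) by (simp add: gauss_binom_same scaleC_one)
qed

text \<open>Coassociativity and the counit axiom are inherited from the regular comodule; stability
  of the span comes from \<open>comult_monomial\<close>. Both \<open>V_comod\<close> and
  \<open>W_comod\<close> are covered.\<close>

lemma comodule_monomials:
  fixes a b c d :: "'l slq2"
  assumes "comult a = a \<otimes>\<^sub>c a + b \<otimes>\<^sub>c c" "comult c = c \<otimes>\<^sub>c a + d \<otimes>\<^sub>c c" "c * a = r *\<^sub>C (a * c)"
  shows "comodule comult (cspan {a ^ (m - k) * c ^ k | k. k \<le> m})" (is "comodule _ ?U")
proof -
  note lin = clinear_algebra_hom[OF algebra_hom_comult]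
  have "comult x \<in> tensor_space UNIV ?U" if "x \<in> ?U" for x
  proof (rule clinear_mem_on_span[OF lin csubspace_tensor_space _ that])
    fix x assume "x \<in> {a ^ (m - k) * c ^ k | k. k \<le> m}"
    then obtain j where j: "j \<le> m" "x = a ^ (m - j) * c ^ j" by blast
    obtain C where "comult x = (\<Sum>k\<le>m. C k \<otimes>\<^sub>c (a ^ (m - k) * c ^ k))"
      using comult_monomial[OF assms, of "m - j" j] j by auto
    also have "\<dots> \<in> tensor_space UNIV ?U"
      by (intro complex_vector.subspace_sum[OF csubspace_tensor_space] tensor_of_mem_tensor_space)
         (auto intro!: complex_vector.span_base)
    finally show "comult x \<in> tensor_space UNIV ?U" .
  qed
  then show ?thesis
    using comodule_comult csubspace_cspan unfolding comodule_def by blast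
qed

text \<open>A character acts on the algebra by translation, an algebra homomorphism, so eigenvalues
  on \<open>a\<close> and \<open>c\<close> determine those on monomials.\<close>

lemma algebra_hom_slice_comult:
  fixes \<phi> :: "'l slq2 \<Rightarrow> complex"
  assumes "algebra_hom \<phi>"
  shows "algebra_hom (\<lambda>x. slice \<phi> (comult x))"
proof (rule algebra_hom_compose[OF _ algebra_hom_comult])
  show "algebra_hom (slice \<phi> :: 'l slq2 \<otimes>\<^sub>c 'l slq2 \<Rightarrow> _)"
    unfolding slice_def using assms unfolding algebra_hom_def[of \<phi>]
    by (intro algebra_hom_tensor_lift cbilinear_slice)
       (simp_all add: scaleC_one mult_scaleC_left mult_scaleC_right scaleC_scaleC mult.commute)
qed

lemma slice_tensor_coaction:
  fixes \<phi> :: "'l slq2 \<Rightarrow> complex"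
  assumes "clinear \<delta>" "clinear \<delta>'" "clinear \<phi>"
    and "\<delta> u = (\<Sum>i\<in>I. C i \<otimes>\<^sub>c w i)" "\<delta>' v = (\<Sum>j\<in>J. D j \<otimes>\<^sub>c z j)"
  shows "slice \<phi> (tensor_coaction \<delta> \<delta>' (u \<otimes>\<^sub>c v)) = (\<Sum>(i, j)\<in>I \<times> J. \<phi> (C i * D j) *\<^sub>C (w i \<otimes>\<^sub>c z j))"
proof -
  have *: "clinear (\<lambda>s. leg_mult s t)" "clinear (\<lambda>t. leg_mult s t)" for s t
    using cbilinear_leg_mult by (auto simp: cbilinear_def)
  have "tensor_coaction \<delta> \<delta>' (u \<otimes>\<^sub>c v) = (\<Sum>i\<in>I. \<Sum>j\<in>J. (C i * D j) \<otimes>\<^sub>c (w i \<otimes>\<^sub>c z j))"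
    unfolding tensor_coaction_of[OF assms(1,2)] assms(4,5) clinear_sum[OF *(1)]
    unfolding clinear_sum[OF *(2)] leg_mult_of ..
  then show ?thesis
    by (simp add: clinear_sum[OF clinear_slice[OF assms(3)]] slice_of[OF assms(3)] sum.cartesian_product
        case_prod_unfold)
qed

section \<open>Characters, operator representations, and l-th powers of the generators\<close>

lemma obtain_torus_character:
  fixes t :: complex
  assumes "t \<noteq> 0"
  obtains \<phi> :: "'l slq2 \<Rightarrow> complex" where "algebra_hom \<phi>" "\<phi> (slq2_gen GA) = t"
    "\<phi> (slq2_gen GB) = 0" "\<phi> (slq2_gen GC) = 0" "\<phi> (slq2_gen GD) = inverse t"
proof -
  let ?h = "case_gen t 0 0 (inverse t)"
  have "free_lift ?h r = 0" if "r \<in> slq2_relations (root_q TYPE('l))" for r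
    by (rule free_lift_relations[OF _ _ _ _ _ _ _ that]) (simp_all add: assms scaleC_complex_def)
  from slq2_universal_property[OF this] obtain \<phi> :: "'l slq2 \<Rightarrow> complex"
    where "algebra_hom \<phi>" "\<And>g. \<phi> (slq2_gen g) = ?h g"
    by blast
  then show ?thesis
    by (intro that[of \<phi>]) auto
qed

text \<open>Since one of \<open>B\<close>, \<open>C\<close> is zero, the terms with
  \<open>bc\<close> disappear from the relations. What remains says that \<open>d\<close> inverts
  \<open>a\<close> and that the dilations q-commute with the coordinate.\<close>

lemma obtain_dilation_rep:
  fixes B C :: lin_op
  assumes "(B = coord_op \<and> C = 0) \<or> (B = 0 \<and> C = coord_op)"
  obtains f :: "'l slq2 \<Rightarrow> lin_op" where "algebra_hom f" "f (slq2_gen GA) = dilation_op (root_q TYPE('l))"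
    "f (slq2_gen GB) = B" "f (slq2_gen GC) = C"
proof -
  let ?q = "root_q TYPE('l)"
  let ?h = "case_gen (dilation_op ?q) B C (dilation_op (inverse ?q))"
  have "free_lift ?h r = 0" if "r \<in> slq2_relations ?q" for r
    by (rule free_lift_relations[OF _ _ _ _ _ _ _ that])
       (use assms in \<open>auto simp: dilation_coord(1)[of ?q] dilation_coord(2)[OF root_q_nonzero] dilation_inverse\<close>)
  from slq2_universal_property[OF this] obtain f :: "'l slq2 \<Rightarrow> lin_op"
    where "algebra_hom f" "\<And>g. f (slq2_gen g) = ?h g"
    by blast
  then show ?thesis
    by (intro that[of f]) auto
qed

lemma scaleC_power: "(r *\<^sub>C x) ^ n = r ^ n *\<^sub>C x ^ n" for x :: "'a::complex_algebra_1"
  by (induction n) (simp_all add: scaleC_one mult_scaleC_left mult_scaleC_right scaleC_scaleC mult.commute)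

lemma slq2_gen_q_commute:
  defines "r \<equiv> inverse (root_q TYPE('l))"
  shows "slq2_gen GC * slq2_gen GA = r *\<^sub>C (slq2_gen GA * slq2_gen GC :: 'l slq2)"
    and "slq2_gen GB * slq2_gen GA = r *\<^sub>C (slq2_gen GA * slq2_gen GB :: 'l slq2)"
    and "slq2_gen GD * slq2_gen GC = r *\<^sub>C (slq2_gen GC * slq2_gen GD :: 'l slq2)"
  unfolding r_def by (simp_all add: slq2_gen_relations(1,2,5)[where 'l = 'l] scaleC_scaleC scaleC_one)

text \<open>Because l is odd, 2 is invertible modulo l, and squaring keeps the root
  primitive.\<close>

lemma root_q_square_primitive:
  assumes "odd CARD('l)"
  shows "(inverse (root_q TYPE('l)))\<^sup>2 ^ i = 1 \<longleftrightarrow> CARD('l) dvd i"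
proof -
  have "CARD('l) \<noteq> 0"
    using assms by (metis even_zero)
  have "(inverse (root_q TYPE('l)))\<^sup>2 ^ i = 1 \<longleftrightarrow> root_q TYPE('l) ^ (2 * i) = 1"
    by (simp add: power_inverse flip: power_mult)
  also have "\<dots> \<longleftrightarrow> CARD('l) dvd i"
    unfolding root_q_power_eq_1_iff[OF \<open>CARD('l) \<noteq> 0\<close>]
    using assms by (simp add: coprime_dvd_mult_right_iff)
  finally show ?thesis .
qed

text \<open>The quantum Frobenius phenomenon: l-th powers of the generators comultiply as in the
  classical group. The factor \<open>1\<close> in the commutation rules matches the hypotheses of
  \<open>comult_monomial\<close> and \<open>comult_power\<close>.\<close>

lemma comult_power_card:
  assumes "odd CARD('l)"
  defines "a \<equiv> slq2_gen GA :: 'l slq2" and "b \<equiv> slq2_gen GB :: 'l slq2"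
    and "c \<equiv> slq2_gen GC :: 'l slq2" and "d \<equiv> slq2_gen GD :: 'l slq2"
    and "l \<equiv> CARD('l)"
  shows "comult (a ^ l) = (a ^ l) \<otimes>\<^sub>c (a ^ l) + (b ^ l) \<otimes>\<^sub>c (c ^ l)"
    and "comult (c ^ l) = (c ^ l) \<otimes>\<^sub>c (a ^ l) + (d ^ l) \<otimes>\<^sub>c (c ^ l)"
    and "c ^ l * a ^ l = 1 *\<^sub>C (a ^ l * c ^ l)"
    and "b ^ l * a ^ l = 1 *\<^sub>C (a ^ l * b ^ l)"
proof -
  define r where "r = inverse (root_q TYPE('l))"
  have l: "l > 0"
    using assms(1) unfolding l_def by (metis even_zero gr0I)
  note comm = slq2_gen_q_commute[where 'l = 'l, folded r_def a_def b_def c_def d_def]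
  have Ql: "(r\<^sup>2) ^ l = 1"
    using root_q_square_primitive[OF assms(1), folded r_def l_def] by simp
  have Qi: "(r\<^sup>2) ^ i \<noteq> 1" if "0 < i" "i < l" for i
    using root_q_square_primitive[OF assms(1), folded r_def l_def] that by (auto dest: dvd_imp_le)
  have "(b \<otimes>\<^sub>c c) * (a \<otimes>\<^sub>c a) = r\<^sup>2 *\<^sub>C ((a \<otimes>\<^sub>c a) * (b \<otimes>\<^sub>c c))"
    "(d \<otimes>\<^sub>c c) * (c \<otimes>\<^sub>c a) = r\<^sup>2 *\<^sub>C ((c \<otimes>\<^sub>c a) * (d \<otimes>\<^sub>c c))"
    by (simp_all add: tensor_times_of comm cbilinear_simps[OF cbilinear_tensor_of] scaleC_scaleC power2_eq_square)
  note binom = this[THEN q_binomial_root_of_unity, OF l Ql Qi]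
  show "comult (a ^ l) = (a ^ l) \<otimes>\<^sub>c (a ^ l) + (b ^ l) \<otimes>\<^sub>c (c ^ l)"
    "comult (c ^ l) = (c ^ l) \<otimes>\<^sub>c (a ^ l) + (d ^ l) \<otimes>\<^sub>c (c ^ l)"
    using binom by (simp_all add: comult_simps(2) comult_slq2_gen a_def b_def c_def d_def tensor_of_power)
  have "r ^ l = 1"
    using root_q_power_eq_1_iff[where 'l = 'l, of l] l by (simp add: r_def l_def power_inverse)
  then have "r ^ (l * l) = 1"
    by (simp add: power_mult)
  then show "c ^ l * a ^ l = 1 *\<^sub>C (a ^ l * c ^ l)" "b ^ l * a ^ l = 1 *\<^sub>C (a ^ l * b ^ l)"
    using q_commute_power[OF comm(1), of l l] q_commute_power[OF comm(2), of l l] by simp_all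
qed

lemma clinear_apply_op: "clinear f \<Longrightarrow> clinear (\<lambda>x. apply_op (f x) g z)"
  by (rule clinearI)
    (simp_all add: clinear_add clinear_scale plus_lin_op.rep_eq scaleC_lin_op.rep_eq scaleC_complex_def)

text \<open>The functional lets the operator of an element act on the constant function 1 and
  evaluates at 1. On the given monomial the value is a power of q.\<close>

lemma slq2_functional_nonzero:
  fixes i j k s :: nat
  assumes "g = GB \<or> g = GC"
  shows "\<exists>\<phi> :: 'l slq2 \<Rightarrow> complex. clinear \<phi> \<and>
    \<phi> ((slq2_gen GA ^ CARD('l)) ^ i * (slq2_gen g ^ CARD('l)) ^ j * (slq2_gen GA ^ k * slq2_gen g ^ s)) \<noteq> 0"
proof -
  let ?a = "slq2_gen GA :: 'l slq2" and ?x = "slq2_gen g :: 'l slq2"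
  obtain f :: "'l slq2 \<Rightarrow> lin_op" where f: "algebra_hom f" "f ?a = dilation_op (root_q TYPE('l))" "f ?x = coord_op"
  proof -
    from assms show thesis
    proof
      assume "g = GB"
      then show thesis
        using obtain_dilation_rep[of coord_op 0] that by blast
    next
      assume "g = GC"
      then show thesis
        using obtain_dilation_rep[of 0 coord_op] that by blast
    qed
  qed
  have "f ((?a ^ CARD('l)) ^ i * (?x ^ CARD('l)) ^ j * (?a ^ k * ?x ^ s)) =
     dilation_op (root_q TYPE('l)) ^ (CARD('l) * i) * coord_op ^ (CARD('l) * j) *
     (dilation_op (root_q TYPE('l)) ^ k * coord_op ^ s)"
    using f by (simp add: algebra_hom_def algebra_hom_power[OF f(1)] power_mult)
  then have "apply_op (f ((?a ^ CARD('l)) ^ i * (?x ^ CARD('l)) ^ j * (?a ^ k * ?x ^ s))) (\<lambda>_. 1) 1 \<noteq> 0"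
    by (simp add: times_lin_op.rep_eq apply_dilation_power apply_coord_power)
  moreover have "clinear (\<lambda>x. apply_op (f x) (\<lambda>_. 1) 1)"
    by (rule clinear_apply_op[OF clinear_algebra_hom[OF f(1)]])
  ultimately show ?thesis by blast
qed

lemma slice_comult_monomial:
  fixes \<phi> :: "'l slq2 \<Rightarrow> complex"
  assumes "algebra_hom \<phi>" "slice \<phi> (comult x) = s *\<^sub>C x" "slice \<phi> (comult y) = t *\<^sub>C y"
  shows "slice \<phi> (comult (x ^ i * y ^ j)) = (s ^ i * t ^ j) *\<^sub>C (x ^ i * y ^ j)"
  using algebra_hom_slice_comult[OF assms(1)] algebra_hom_power[OF algebra_hom_slice_comult[OF assms(1)]]
  by (simp add: algebra_hom_def assms(2,3) scaleC_power mult_scaleC_left mult_scaleC_right scaleC_scaleC mult.commute)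

subsection \<open>Irreducibility\<close>

text \<open>The weight is \<open>2 ^ (l * n + m)\<close> divided by \<open>4 ^ (l * i + j)\<close>.
  It determines \<open>l * i + j\<close>, and division by \<open>l\<close> recovers \<open>i\<close>
  and \<open>j\<close> because \<open>j \<le> m < l\<close>.\<close>

lemma weight_inj:
  fixes n m l :: nat
  assumes "m < l"
  shows "inj_on (\<lambda>(i, j). ((2 ^ l) ^ (n - i) * (inverse 2 ^ l) ^ i) * (2 ^ (m - j) * inverse 2 ^ j) :: complex) ({..n} \<times> {..m})"
proof -
  let ?e = "\<lambda>i j. ((2 ^ l) ^ (n - i) * (inverse 2 ^ l) ^ i) * (2 ^ (m - j) * inverse 2 ^ j) :: complex"
  have pow: "x ^ (k - i) * inverse x ^ i * (x\<^sup>2) ^ i = x ^ k" if "x \<noteq> 0" "i \<le> k" for x :: complex and i k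
  proof -
    have "x ^ (k - i) * inverse x ^ i * (x\<^sup>2) ^ i = x ^ (k - i) * (inverse x * x\<^sup>2) ^ i"
      by (simp only: power_mult_distrib mult.assoc)
    also have "inverse x * x\<^sup>2 = x"
      using that by (simp add: power2_eq_square)
    finally show ?thesis
      using that by (simp flip: power_add)
  qed
  have e: "?e i j * 4 ^ (l * i + j) = (2 ^ l) ^ n * 2 ^ m" if "i \<le> n" "j \<le> m" for i j
  proof -
    have "((4 :: complex) ^ l) ^ i = ((2 ^ l)\<^sup>2) ^ i"
      unfolding power2_eq_square power_mult_distrib[symmetric] by simp
    then have "?e i j * 4 ^ (l * i + j) =
      ((2 ^ l) ^ (n - i) * inverse (2 ^ l) ^ i * ((2 ^ l)\<^sup>2) ^ i) * (2 ^ (m - j) * inverse 2 ^ j * (2\<^sup>2) ^ j)"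
      by (simp add: power_add power_mult power_one_over inverse_eq_divide)
    also have "\<dots> = (2 ^ l) ^ n * 2 ^ m"
      by (subst (1 2) pow) (use that in auto)
    finally show ?thesis .
  qed
  have "i = i' \<and> j = j'"
    if ij: "i \<le> n" "j \<le> m" "i' \<le> n" "j' \<le> m" and eq: "?e i j = ?e i' j'" for i j i' j'
  proof -
    have "?e i j * 4 ^ (l * i + j) = ?e i j * 4 ^ (l * i' + j')"
      using e[OF ij(1,2)] e[OF ij(3,4)] eq by simp
    then have "(4 :: complex) ^ (l * i + j) = 4 ^ (l * i' + j')"
      by simp
    \<comment> \<open>Norms move the equation to the reals, where powers of 4 determine the
      exponent.\<close>
    then have "norm ((4 :: complex) ^ (l * i + j)) = norm ((4 :: complex) ^ (l * i' + j'))"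
      by simp
    then have "l * i + j = l * i' + j'"
      by (simp add: norm_power)
    moreover have "(l * i + j) div l = i" "(l * i' + j') div l = i'"
      using ij assms by simp_all
    ultimately show ?thesis
      by simp
  qed
  moreover define E where "E = ?e"
  ultimately have "inj_on (\<lambda>(i, j). E i j) ({..n} \<times> {..m})"
    by (intro inj_onI) auto
  then show ?thesis
    by (simp only: E_def)
qed

theorem mainTheorem2:
  fixes n m :: nat
  assumes "CARD('l) \<ge> 3" and "odd CARD('l)" and "m \<in> {0..CARD('l) - 1}"
  shows "irreducible_comodule (tensor_coaction comult comult)
    (tensor_space (W_comod n :: 'l slq2 set) (V_comod m :: 'l slq2 set))"
proof -
  define l where "l = CARD('l)"
  define r where "r = inverse (root_q TYPE('l))"
  define a b c d where "a = (slq2_gen GA :: 'l slq2)" and "b = (slq2_gen GB :: 'l slq2)"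
    and "c = (slq2_gen GC :: 'l slq2)" and "d = (slq2_gen GD :: 'l slq2)"
  have ml: "m < l"
    using assms(1,3) by (auto simp: l_def)
  have lin: "clinear (comult :: 'l slq2 \<Rightarrow> _)"
    by (rule clinear_algebra_hom[OF algebra_hom_comult])
  let ?\<delta> = "tensor_coaction comult comult :: 'l slq2 \<otimes>\<^sub>c 'l slq2 \<Rightarrow> _"
  let ?U = "tensor_space (W_comod n :: 'l slq2 set) (V_comod m :: 'l slq2 set)"
  note \<delta>_lin = clinear_tensor_coaction[OF lin lin]
  note comm = slq2_gen_q_commute[where 'l = 'l, folded r_def a_def b_def c_def d_def]
  have \<Delta>: "comult a = a \<otimes>\<^sub>c a + b \<otimes>\<^sub>c c" "comult c = c \<otimes>\<^sub>c a + d \<otimes>\<^sub>c c"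
    by (simp_all add: a_def b_def c_def d_def comult_slq2_gen)
  note frob = comult_power_card[OF assms(2), folded l_def a_def b_def c_def d_def]
  have V: "V_comod m = cspan {a ^ (m - k) * c ^ k | k. k \<le> m}"
    and W: "W_comod n = cspan {(a ^ l) ^ (n - k) * (c ^ l) ^ k | k. k \<le> n}"
    by (simp_all add: V_comod_def W_comod_def a_def c_def l_def)
  define u where "u i = (a ^ l) ^ (n - i) * (c ^ l) ^ i" for i
  define v where "v j = a ^ (m - j) * c ^ j" for j
  define w where "w = (\<lambda>(i, j). u i \<otimes>\<^sub>c v j)"
  define I where "I = {..n} \<times> {..m}"
  have I: "finite I"
    by (simp add: I_def)
  have U: "?U = cspan (w ` I)"
    unfolding V W tensor_space_cspan
    by (rule arg_cong[of _ _ cspan]) (force simp: w_def I_def u_def v_def)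
  have comod: "comodule ?\<delta> ?U"
    unfolding V W
    by (intro comodule_tensor_space comodule_monomials[OF \<Delta> comm(1)] comodule_monomials[OF frob(1-3)])
  have counit: "algebra_hom (counit :: 'l slq2 \<Rightarrow> _)"
    by (rule algebra_hom_counit)
  have "w (0, 0) \<noteq> 0"
  proof
    assume "w (0, 0) = 0"
    \<comment> \<open>The counit is 1 on powers of \<open>a\<close>: slicing by it leaves
      \<open>a ^ m\<close>, and a second application gives 1.\<close>
    then have "slice counit ((a ^ l) ^ n \<otimes>\<^sub>c a ^ m) = 0"
      by (simp add: w_def u_def v_def clinear_zero[OF clinear_slice[OF clinear_algebra_hom[OF counit]]])
    moreover have "counit a = 1"
      by (simp add: a_def counit_slq2_gen)
    ultimately have "a ^ m = 0"
      by (simp add: slice_of[OF clinear_algebra_hom[OF counit]] algebra_hom_power[OF counit] scaleC_one)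
    then have "counit (a ^ m) = 0"
      by (simp add: clinear_zero[OF clinear_algebra_hom[OF counit]])
    with \<open>counit a = 1\<close> show False
      by (simp add: algebra_hom_power[OF counit])
  qed
  moreover have "w (0, 0) \<in> ?U"
    unfolding U by (rule complex_vector.span_base) (simp add: I_def)
  ultimately have nonzero: "?U \<noteq> {0}"
    by blast
  \<comment> \<open>The torus parameter 2 is not a root of unity, so different exponents give
    different weights.\<close>
  obtain \<psi> :: "'l slq2 \<Rightarrow> complex" where \<psi>: "algebra_hom \<psi>" "\<psi> a = 2" "\<psi> b = 0" "\<psi> c = 0" "\<psi> d = inverse 2"
    by (rule obtain_torus_character[of 2]) (simp, rule that, simp_all add: a_def b_def c_def d_def)
  define t where "t = (\<lambda>(i, j). ((2 ^ l) ^ (n - i) * (inverse 2 ^ l) ^ i) * (2 ^ (m - j) * inverse 2 ^ j) :: complex)"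
  note \<psi>_lin = clinear_slice[OF clinear_algebra_hom[OF \<psi>(1)]]
  have ac: "slice \<psi> (comult a) = 2 *\<^sub>C a" "slice \<psi> (comult c) = inverse 2 *\<^sub>C c"
    unfolding \<Delta> by (simp_all add: clinear_add[OF \<psi>_lin] slice_of[OF clinear_algebra_hom[OF \<psi>(1)]] \<psi>)
  have acl: "slice \<psi> (comult (a ^ l)) = 2 ^ l *\<^sub>C a ^ l" "slice \<psi> (comult (c ^ l)) = inverse 2 ^ l *\<^sub>C c ^ l"
    using slice_comult_monomial[OF \<psi>(1) ac, of l 0] slice_comult_monomial[OF \<psi>(1) ac, of 0 l] by simp_all
  have weight: "slice \<psi> (?\<delta> (w p)) = t p *\<^sub>C w p" for p
    by (simp add: w_def t_def u_def v_def tensor_coaction_of[OF lin lin] slice_leg_mult[OF \<psi>(1)]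
        slice_comult_monomial[OF \<psi>(1) ac] slice_comult_monomial[OF \<psi>(1) acl] cbilinear_simps[OF cbilinear_tensor_of]
        scaleC_scaleC mult.commute split: prod.split)
  have inj: "inj_on t I"
    unfolding t_def I_def by (rule weight_inj[OF ml])
  have "M = {0} \<or> M = ?U" if M: "subcomodule ?\<delta> ?U M" for M
  proof (cases "M = {0}")
    case False
    have sub: "csubspace M" and MU: "M \<subseteq> ?U"
      using M by (auto simp: subcomodule_def)
    have slice_M: "slice \<phi> (?\<delta> x) \<in> M" if "x \<in> M" "clinear \<phi>" for x \<phi>
      using slice_mem[OF that(2) sub] M that(1) by (auto simp: subcomodule_def)
    \<comment> \<open>Each weight space in the span of the \<open>w p\<close> is a line, so
      \<open>M\<close> contains every basis vector that occurs in one of its elements with nonzero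
      coefficient.\<close>
    have component: "w p \<in> M" if "(\<Sum>p\<in>I. f p *\<^sub>C w p) \<in> M" "p \<in> I" "f p \<noteq> 0" for f p
    proof -
      have "f p *\<^sub>C w p \<in> M"
      proof (rule eigenvector_components[OF sub _ _ I inj _ that(1,2)])
        show "clinear (\<lambda>x. slice \<psi> (?\<delta> x))"
          by (rule clinear_compose[OF \<psi>_lin \<delta>_lin])
        show "slice \<psi> (?\<delta> x) \<in> M" if "x \<in> M" for x
          by (rule slice_M[OF that clinear_algebra_hom[OF \<psi>(1)]])
        show "slice \<psi> (?\<delta> (f p *\<^sub>C w p)) = t p *\<^sub>C f p *\<^sub>C w p" for p
          by (simp add: clinear_scale[OF \<delta>_lin] clinear_scale[OF \<psi>_lin] weight scaleC_scaleC mult.commute)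
      qed
      then have "inverse (f p) *\<^sub>C f p *\<^sub>C w p \<in> M"
        by (rule complex_vector.subspace_scale[OF sub])
      then show ?thesis
        using that(3) by (simp add: scaleC_scaleC scaleC_one)
    qed
    have "0 \<in> M"
      by (rule complex_vector.subspace_0[OF sub])
    with False obtain x where x: "x \<in> M" "x \<noteq> 0"
      by auto
    then obtain f where f: "x = (\<Sum>p\<in>I. f p *\<^sub>C w p)"
      using MU cspan_image_finite[OF I] unfolding U by blast
    with x(2) obtain p where "p \<in> I" "f p *\<^sub>C w p \<noteq> 0"
      by (meson sum.neutral)
    then have "w p \<in> M"
      using component[of f p] x(1) f by auto
    obtain i j where ij: "p = (i, j)" "i \<le> n" "j \<le> m"
      using \<open>p \<in> I\<close> by (auto simp: I_def)
    have "w (0, 0) \<in> M"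
    proof -
      obtain C where C: "comult (u i) = (\<Sum>k\<le>n. C k \<otimes>\<^sub>c u k)" "C 0 = u i"
        using comult_monomial[OF frob(1-3), of "n - i" i] ij unfolding u_def by auto
      obtain D where D: "comult (v j) = (\<Sum>k\<le>m. D k \<otimes>\<^sub>c v k)" "D 0 = v j"
        using comult_monomial[OF \<Delta> comm(1), of "m - j" j] ij unfolding v_def by auto
      \<comment> \<open>The coefficient of \<open>w (0, 0)\<close> is
        \<open>\<phi> (C 0 * D 0)\<close>, which is \<open>\<phi> (u i * v j)\<close>; the
        functional is chosen to be nonzero there.\<close>
      obtain \<phi> :: "'l slq2 \<Rightarrow> complex" where \<phi>: "clinear \<phi>" "\<phi> (u i * v j) \<noteq> 0"
        using slq2_functional_nonzero[of GC "n - i" i "m - j" j] unfolding u_def v_def a_def c_def l_def by blast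
      have "slice \<phi> (?\<delta> (w p)) = (\<Sum>(i, j)\<in>I. \<phi> (C i * D j) *\<^sub>C (u i \<otimes>\<^sub>c v j))"
        unfolding w_def ij I_def prod.case by (rule slice_tensor_coaction[OF lin lin \<phi>(1) C(1) D(1)])
      also have "\<dots> = (\<Sum>p\<in>I. \<phi> (C (fst p) * D (snd p)) *\<^sub>C w p)"
        by (simp add: w_def case_prod_unfold)
      finally show ?thesis
        using slice_M[OF \<open>w p \<in> M\<close> \<phi>(1)] \<phi>(2) C(2) D(2)
        by (intro component[of "\<lambda>p. \<phi> (C (fst p) * D (snd p))"]) (simp_all add: I_def)
    qed
    have "w (i, j) \<in> M" if ij: "i \<le> n" "j \<le> m" for i j
    proof -
      \<comment> \<open>The l-th powers commute, so \<open>comult_power\<close> applies with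
        \<open>r = 1\<close> and gives ordinary binomial coefficients, nonzero in characteristic
        0.\<close>
      let ?C = "\<lambda>k. gauss_binom (1\<^sup>2) n k *\<^sub>C ((a ^ l) ^ (n - k) * (b ^ l) ^ k)"
      let ?D = "\<lambda>k. gauss_binom (r\<^sup>2) m k *\<^sub>C (a ^ (m - k) * b ^ k)"
      have C: "comult (u 0) = (\<Sum>k\<le>n. ?C k \<otimes>\<^sub>c u k)"
        using comult_power[OF frob(1,3,4), of n] by (simp add: u_def)
      have D: "comult (v 0) = (\<Sum>k\<le>m. ?D k \<otimes>\<^sub>c v k)"
        using comult_power[OF \<Delta>(1) comm(1,2), of m] by (simp add: v_def)
      have "gauss_binom (1\<^sup>2) n i \<noteq> (0 :: complex)"
        using ij by (simp add: gauss_binom_one)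
      \<comment> \<open>No exponent from 1 to \<open>m\<close> is divisible by l, since
        \<open>m < l\<close>.\<close>
      moreover have "gauss_binom (r\<^sup>2) m j \<noteq> 0"
        using root_q_square_primitive[OF assms(2)] ml ij
        by (intro gauss_binom_nonzero) (auto simp: r_def l_def dest: dvd_imp_le)
      moreover obtain \<phi> :: "'l slq2 \<Rightarrow> complex" where \<phi>: "clinear \<phi>"
        "\<phi> ((a ^ l) ^ (n - i) * (b ^ l) ^ i * (a ^ (m - j) * b ^ j)) \<noteq> 0"
        using slq2_functional_nonzero[of GB "n - i" i "m - j" j] unfolding a_def b_def l_def by blast
      ultimately have CD: "\<phi> (?C i * ?D j) \<noteq> 0"
        by (simp add: mult_scaleC_left mult_scaleC_right clinear_scale[OF \<phi>(1)] scaleC_complex_def)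
      have "slice \<phi> (?\<delta> (w (0, 0))) = (\<Sum>(i, j)\<in>I. \<phi> (?C i * ?D j) *\<^sub>C (u i \<otimes>\<^sub>c v j))"
        unfolding w_def I_def prod.case by (rule slice_tensor_coaction[OF lin lin \<phi>(1) C D])
      also have "\<dots> = (\<Sum>p\<in>I. \<phi> (?C (fst p) * ?D (snd p)) *\<^sub>C w p)"
        by (simp add: w_def case_prod_unfold)
      finally show ?thesis
        using slice_M[OF \<open>w (0, 0) \<in> M\<close> \<phi>(1)] CD ij
        by (intro component[of "\<lambda>p. \<phi> (?C (fst p) * ?D (snd p))"]) (simp_all add: I_def)
    qed
    then have "w ` I \<subseteq> M"
      by (auto simp: I_def)
    then have "?U \<subseteq> M"
      unfolding U by (rule complex_vector.span_minimal[OF _ sub])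
    with MU show ?thesis by blast
  qed simp
  with comod nonzero show ?thesis
    unfolding irreducible_comodule_def by blast
qed

end
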